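(* Let $p\neq 0$ be a complex number, let $n$ be a non-negative integer and let $n_1,\ldots,n_k,t_1,\ldots,t_k$ ($k\geq 1$) be positive integers such that (a) $n_j\geq t_j$ for all $1\leq j\leq k$, and (b) $n+\sum_{j=1}^{k}n_j\geq 2+\sum_{j=1}^{k}t_j$. Let $\mathcal{F}$ be a family of holomorphic functions in a domain $D\subset\mathbb{C}$ such that for every pair of functions $f,g\in\mathcal{F}$, the functions $f^n(f^{n_1})^{(t_1)}\cdots(f^{n_k})^{(t_k)}$ and $g^n(g^{n_1})^{(t_1)}\cdots(g^{n_k})^{(t_k)}$ share $p$ IM on $D$. Then $\mathcal{F}$ is normal in $D$.
   Context: Here $(f^{m})^{(t)}$ denotes the $t$-th derivative of the $m$-th power $f^m$ of $f$. Two meromorphic functions $F,G$ on $D$ share the value $p$ IM (ignoring multiplicity) on $D$ if $F-p$ and $G-p$ have the same zeros in $D$, ignoring multiplicities. A family $\mathcal{F}$ of meromorphic (in particular, holomorphic) functions on a domain $D\subset\mathbb{C}$ is normal in $D$ if every sequence in $\mathcal{F}$ has a subsequence which converges spherically uniformly (i.e. uniformly with respect to the spherical metric) on compact subsets of $D$ to a meromorphic function or to $\infty$. *)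

theory Defs
  imports "HOL-Complex_Analysis.Complex_Analysis"
begin

(* The Riemann sphere, with None as the point at infinity. *)
type_synonym sphere = "complex option"

(* Chordal distance for the sphere of radius 1. *)
fun chordal_dist :: "sphere \<Rightarrow> sphere \<Rightarrow> real" where
  "chordal_dist (Some z) (Some w) =
     2 * norm (z - w) / (sqrt (1 + (norm z)\<^sup>2) * sqrt (1 + (norm w)\<^sup>2))"
| "chordal_dist (Some z) None = 2 / sqrt (1 + (norm z)\<^sup>2)"
| "chordal_dist None (Some w) = 2 / sqrt (1 + (norm w)\<^sup>2)"
| "chordal_dist None None = 0"

(* Great-circle distance: a chord of length c in the unit sphere subtends an arc of
   length 2 arcsin (c / 2). *)
definition spherical_dist :: "sphere \<Rightarrow> sphere \<Rightarrow> real" where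
  "spherical_dist a b = 2 * arcsin (chordal_dist a b / 2)"

(* A nicely meromorphic function has the conventional value 0 at its poles; this is the
   sphere-valued function that it represents. *)
definition sphere_val :: "(complex \<Rightarrow> complex) \<Rightarrow> complex \<Rightarrow> sphere" where
  "sphere_val f z = (if is_pole f z then None else Some (f z))"

definition spherically_locally_uniform_limit ::
    "complex set \<Rightarrow> (nat \<Rightarrow> complex \<Rightarrow> sphere) \<Rightarrow> (complex \<Rightarrow> sphere) \<Rightarrow> bool" where
  "spherically_locally_uniform_limit D F G \<longleftrightarrow>
     (\<forall>K. compact K \<and> K \<subseteq> D \<longrightarrow>
        (\<forall>e>0. \<forall>\<^sub>F m in sequentially. \<forall>z\<in>K. spherical_dist (F m z) (G z) < e))"

definition normal_family :: "(complex \<Rightarrow> complex) set \<Rightarrow> complex set \<Rightarrow> bool" where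
  "normal_family \<F> D \<longleftrightarrow>
     (\<forall>s :: nat \<Rightarrow> complex \<Rightarrow> complex. range s \<subseteq> \<F> \<longrightarrow>
        (\<exists>r :: nat \<Rightarrow> nat. strict_mono r \<and>
           ((\<exists>g. g nicely_meromorphic_on D \<and>
               spherically_locally_uniform_limit D (\<lambda>m. sphere_val (s (r m))) (sphere_val g)) \<or>
            spherically_locally_uniform_limit D (\<lambda>m. sphere_val (s (r m))) (\<lambda>_. None))))"

(* Going through sphere_val keeps poles from counting as zeros of F - p when p = 0. *)
definition share_IM ::
    "(complex \<Rightarrow> complex) \<Rightarrow> (complex \<Rightarrow> complex) \<Rightarrow> complex \<Rightarrow> complex set \<Rightarrow> bool" where
  "share_IM F G p D \<longleftrightarrow>
     {z \<in> D. sphere_val F z = Some p} = {z \<in> D. sphere_val G z = Some p}"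

definition diff_monomial ::
    "nat \<Rightarrow> nat \<Rightarrow> (nat \<Rightarrow> nat) \<Rightarrow> (nat \<Rightarrow> nat) \<Rightarrow> (complex \<Rightarrow> complex) \<Rightarrow> complex \<Rightarrow> complex" where
  "diff_monomial n k ns ts f =
     (\<lambda>z. f z ^ n * (\<Prod>j=1..k. (deriv ^^ ts j) (\<lambda>w. f w ^ ns j) z))"

end

theory Submission
  imports Defs
begin

text \<open>
  Write \<open>P\<close> for the operator \<open>diff_monomial n k ns ts\<close>, \<open>N = n + (\<Sum>j. ns j)\<close> for its degree and
  \<open>T = (\<Sum>j. ts j)\<close> for its weight, so that \<open>N \<ge> T + 2\<close>. The spherical derivative of a holomorphic
  \<open>f\<close> is \<open>\<bar>f'\<bar> / (1 + \<bar>f\<bar>\<^sup>2)\<close>. If it is bounded near every point, uniformly over the family, then the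
  family is normal (\<open>marty_imp_normal_family\<close>).

  Suppose it is unbounded near some point. Then the rescaling lemma of Zalcman and Pang
  (\<open>zalcman_pang\<close>) provides members \<open>f m\<close> of the family, centres \<open>b m\<close> converging to a point
  \<open>z0\<close> of \<open>D\<close>, and scales \<open>\<rho> m\<close> tending to \<open>0\<close>, such that
  \<open>h m w = f m (b m + \<rho> m * w) / \<rho> m powr \<alpha>\<close> converges locally uniformly to a nonconstant entire
  function \<open>g\<close>. Any exponent \<open>0 \<le> \<alpha> < 1\<close> may be prescribed. The choice \<open>\<alpha> = T / N\<close> makes the
  powers of \<open>\<rho> m\<close> cancel, so \<open>P (h m) w = P (f m) (b m + \<rho> m * w)\<close>.

  The core is that \<open>P g\<close> is not constant and takes the value \<open>p\<close> at two distinct points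
  (\<open>diff_monomial_two_values\<close>). By Hurwitz, \<open>P (h m)\<close> then takes the value \<open>p\<close> near both of them for
  large \<open>m\<close>, hence \<open>P (f m)\<close> has two distinct \<open>p\<close>-points, both of which tend to \<open>z0\<close>. As the
  \<open>p\<close>-points are shared, they are \<open>p\<close>-points of the single function \<open>P (f 0)\<close>, so \<open>P (f 0)\<close> is
  constantly \<open>p\<close>; by sharing again every \<open>P (f m)\<close> is, and so is \<open>P g\<close>, which is a contradiction.

  For this core it is essential that \<open>g\<close> has exponential type: it has a bounded spherical
  derivative, and such functions grow at most exponentially. This and most of the compactness
  arguments rest on one estimate, \<open>clunie_hayman_bound\<close>: a bound on the spherical derivative
  propagates a bound for \<open>\<bar>f\<bar>\<close> from one point to another. Given exponential type, suppose that \<open>P g\<close> takes the value \<open>p\<close> at most at one point \<open>b\<close>. Then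
  \<open>P g - p = (z - b) ^ l * exp (c * z + d)\<close>. Since \<open>N \<ge> T + 2\<close>, every zero of \<open>g\<close> is at least a
  double zero of \<open>P g\<close>, hence a zero of the derivative of the right-hand side that is different
  from \<open>b\<close>; there is at most one such point \<open>a\<close>. So \<open>g = (z - a) ^ s * exp (c' * z + d')\<close>, and for
  such an explicit \<open>g\<close> the claim can be checked directly: \<open>P g\<close> is a polynomial times an
  exponential if \<open>c' \<noteq> 0\<close>, and otherwise a multiple of a power of \<open>z - a\<close> with exponent at least \<open>2\<close>.
\<close>

section \<open>Holomorphic functions with positive real part\<close>

text \<open>
  This is the Schwarz lemma after the conformal map \<open>u \<mapsto> (u - k a) / (u + cnj (k a))\<close> of the right
  half plane onto the unit disc.
\<close>

lemma half_plane_schwarz: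
  assumes k: "k holomorphic_on ball a r" and pos: "\<And>z. z \<in> ball a r \<Longrightarrow> 0 < Re (k z)"
    and z: "z \<in> ball a r"
  shows "norm (k z - k a) \<le> norm (z - a) / r * norm (k z + cnj (k a))"
proof -
  have r: "r > 0"
    using z by (metis ball_eq_empty empty_iff not_le)
  \<comment> \<open>a self-map of the unit disc that fixes \<open>0\<close>\<close>
  define \<psi> where "\<psi> \<xi> = (k (a + of_real r * \<xi>) - k a) / (k (a + of_real r * \<xi>) + cnj (k a))" for \<xi>
  have ib: "a + of_real r * \<xi> \<in> ball a r" if "norm \<xi> < 1" for \<xi>
    using that r by (simp add: dist_norm norm_mult)
  have a: "Re (k a) > 0"
    using pos r by simp
  have lt: "norm (u - v) < norm (u + cnj v)" if "Re u > 0" "Re v > 0" for u v :: complex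
  proof -
    have "(norm (u + cnj v))\<^sup>2 - (norm (u - v))\<^sup>2 = 4 * Re u * Re v"
      unfolding cmod_power2 by (simp add: algebra_simps power2_eq_square)
    then have "(norm (u - v))\<^sup>2 < (norm (u + cnj v))\<^sup>2"
      using that by (smt (verit) mult_pos_pos)
    then show ?thesis
      by (rule power_less_imp_less_base) simp
  qed
  have nz: "norm (k (a + of_real r * \<xi>) + cnj (k a)) > 0" if "norm \<xi> < 1" for \<xi>
    using lt[OF pos[OF ib[OF that]] a] by (smt (verit) norm_ge_zero)
  have "\<psi> holomorphic_on ball 0 1"
  proof -
    have "(\<lambda>\<xi>. k (a + of_real r * \<xi>)) holomorphic_on ball 0 1"
      by (rule holomorphic_on_compose_gen[OF _ k, unfolded o_def]) (auto intro!: holomorphic_intros ib)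
    then show ?thesis
      unfolding \<psi>_def by (intro holomorphic_intros) (use nz in force)+
  qed
  moreover have "\<psi> 0 = 0" by (simp add: \<psi>_def)
  moreover have "norm (\<psi> \<xi>) < 1" if "norm \<xi> < 1" for \<xi>
    using lt[OF pos[OF ib[OF that]] a] nz[OF that] by (simp add: \<psi>_def norm_divide divide_simps)
  ultimately have S: "norm \<xi> < 1 \<Longrightarrow> norm (\<psi> \<xi>) \<le> norm \<xi>" for \<xi>
    by (rule Schwarz_Lemma(1))
  define \<xi> where "\<xi> = (z - a) / of_real r"
  have n: "norm \<xi> = norm (z - a) / r"
    using r by (simp add: \<xi>_def norm_divide)
  moreover have "norm (z - a) < r"
    using z by (simp add: dist_norm norm_minus_commute)
  ultimately have n1: "norm \<xi> < 1"
    using r by (metis divide_less_eq_1_pos)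
  have "a + of_real r * \<xi> = z"
    using r by (simp add: \<xi>_def)
  with S[OF n1] nz[OF n1] show ?thesis
    by (simp add: \<psi>_def norm_divide pos_divide_le_eq flip: n)
qed

lemma half_plane_harnack:
  assumes "k holomorphic_on ball a r" "\<And>z. z \<in> ball a r \<Longrightarrow> 0 < Re (k z)" "z \<in> ball a r"
  shows "Re (k a) * (r - norm (z - a)) \<le> Re (k z) * (r + norm (z - a))"
proof -
  have r: "r > 0"
    using assms(3) by (metis ball_eq_empty empty_iff not_le)
  define x where "x = norm (z - a) / r"
  have x: "0 \<le> x" "x < 1"
    using assms(3) r by (auto simp: x_def dist_norm norm_minus_commute divide_simps)
  have "norm (k z - k a) \<le> x * norm (k z + cnj (k a))"
    using half_plane_schwarz[OF assms] by (simp add: x_def)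
  then have "(norm (k z - k a))\<^sup>2 \<le> (x * norm (k z + cnj (k a)))\<^sup>2"
    by (rule power_mono) simp
  then have e1: "(Re (k z) - Re (k a))\<^sup>2 + (Im (k z) - Im (k a))\<^sup>2
       \<le> x\<^sup>2 * ((Re (k z) + Re (k a))\<^sup>2 + (Im (k z) - Im (k a))\<^sup>2)"
    by (simp add: power_mult_distrib cmod_power2)
  have e2: "x\<^sup>2 * (Im (k z) - Im (k a))\<^sup>2 \<le> 1 * (Im (k z) - Im (k a))\<^sup>2"
    using x by (intro mult_right_mono) (auto simp: power_le_one)
  have "(Re (k z) - Re (k a))\<^sup>2 \<le> (x * (Re (k z) + Re (k a)))\<^sup>2"
  proof -
    have *: "A \<le> c * B" if "A + E \<le> c * (B + E)" "c * E \<le> 1 * E" for A B E c :: real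
      using that by (simp add: distrib_left)
    show ?thesis
      unfolding power_mult_distrib[of x] by (rule *[OF e1 e2])
  qed
  then have "Re (k a) - Re (k z) \<le> x * (Re (k z) + Re (k a))"
    unfolding power2_commute[of "Re (k z)" "Re (k a)"]
    by (rule power2_le_imp_le) (use assms(2)[OF assms(3)] assms(2)[of a] r x in \<open>auto intro!: mult_nonneg_nonneg\<close>)
  then have "r * (Re (k a) - Re (k z)) \<le> r * (x * (Re (k z) + Re (k a)))"
    using r by (intro mult_left_mono) auto
  also have "\<dots> = norm (z - a) * (Re (k z) + Re (k a))"
    using r by (simp add: x_def)
  finally show ?thesis by (simp add: algebra_simps)
qed

lemma half_plane_deriv_bound:
  assumes "k holomorphic_on ball a r" "\<And>z. z \<in> ball a r \<Longrightarrow> 0 < Re (k z)" "r > 0"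
  shows "norm (deriv k a) \<le> 2 * Re (k a) / r"
proof -
  have "(k has_field_derivative deriv k a) (at a)"
    using assms by (intro holomorphic_derivI[of _ "ball a r"]) auto
  then have 1: "((\<lambda>z. norm ((k z - k a) / (z - a))) \<longlongrightarrow> norm (deriv k a)) (at a)"
    by (intro tendsto_norm) (simp add: DERIV_def has_field_derivative_iff)
  have "isCont k a"
    using assms by (metis centre_in_ball continuous_on_eq_continuous_at holomorphic_on_imp_continuous_on open_ball)
  then have "((\<lambda>z. norm (k z + cnj (k a)) / r) \<longlongrightarrow> norm (k a + cnj (k a)) / r) (at a)"
    using assms(3) by (intro tendsto_intros) (auto simp: isCont_def)
  moreover have "k a + cnj (k a) = of_real (2 * Re (k a))"
    by (simp add: complex_add_cnj)
  moreover have "\<bar>2 * Re (k a)\<bar> = 2 * Re (k a)"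
    using assms(2)[of a] assms(3) by auto
  ultimately have 2: "((\<lambda>z. norm (k z + cnj (k a)) / r) \<longlongrightarrow> 2 * Re (k a) / r) (at a)"
    by (metis norm_of_real)
  have "eventually (\<lambda>z. z \<in> ball a r - {a}) (at a)"
    using assms(3) by (intro eventually_at_in_open) auto
  then have "eventually (\<lambda>z. norm ((k z - k a) / (z - a)) \<le> norm (k z + cnj (k a)) / r) (at a)"
  proof eventually_elim
    case (elim z)
    then show ?case
      using half_plane_schwarz[OF assms(1,2), of z] assms(3)
      by (simp add: norm_divide divide_simps mult.commute)
  qed
  then show ?thesis
    using 1 2 by (intro tendsto_le[OF _ 2 1]) auto
qed

lemma half_plane_norm_bound:
  assumes "k holomorphic_on ball a r" "\<And>z. z \<in> ball a r \<Longrightarrow> 0 < Re (k z)"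
    and "norm (z - a) \<le> r / 2" "r > 0"
  shows "norm (k z) \<le> 3 * norm (k a)"
proof -
  have z: "z \<in> ball a r"
    using assms by (simp add: dist_norm norm_minus_commute)
  have "norm (k z - k a) \<le> norm (z - a) / r * norm (k z + cnj (k a))"
    using half_plane_schwarz[OF assms(1,2) z] .
  also have "\<dots> \<le> (1/2) * norm (k z + cnj (k a))"
    using assms by (intro mult_right_mono) (auto simp: divide_simps)
  also have "\<dots> \<le> (1/2) * (norm (k z) + norm (k a))"
    using norm_triangle_ineq[of "k z" "cnj (k a)"] by simp
  finally show ?thesis
    using norm_triangle_ineq2[of "k z" "k a"] by (simp add: field_simps)
qed

lemma log_on_ball:
  assumes "f holomorphic_on ball a r" "\<And>z. z \<in> ball a r \<Longrightarrow> f z \<noteq> 0"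
  obtains h where "h holomorphic_on ball a r" "\<And>z. z \<in> ball a r \<Longrightarrow> f z = exp (h z)"
proof -
  have "simply_connected (ball a r)"
    by (simp add: convex_imp_simply_connected)
  then show ?thesis
    using simply_connected_eq_holomorphic_log[of "ball a r"] assms that by auto
qed

section \<open>Growth of functions with bounded spherical derivative\<close>

text \<open>
  Let \<open>x\<close> be the point of \<open>{\<bar>f\<bar> \<le> C}\<close> nearest to \<open>w'\<close>. On the open disc about \<open>w'\<close> that has \<open>x\<close> on
  its boundary, \<open>ln (\<bar>f\<bar> / C)\<close> is a positive harmonic function, so by Harnack it grows from \<open>x\<close>
  towards the centre at a rate of at least half its value at \<open>w'\<close> divided by the radius. The rate is
  bounded by \<open>\<bar>f'\<bar> / C\<close> at \<open>x\<close>, and there the bound on the spherical derivative is one on \<open>\<bar>f'\<bar>\<close>.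
\<close>

lemma clunie_hayman_bound:
  assumes holf: "f holomorphic_on ball w' R" and M: "M \<ge> 0"
    and sph: "\<And>z. z \<in> ball w' R \<Longrightarrow> norm (deriv f z) \<le> M * (1 + (norm (f z))\<^sup>2)"
    and w: "w \<in> ball w' R" and C: "C > 0" "norm (f w) \<le> C"
  shows "norm (f w') \<le> C * exp (2 * M * (C + 1/C) * norm (w - w'))"
proof (cases "norm (f w') \<le> C")
  case True
  have "C * 1 \<le> C * exp (2 * M * (C + 1/C) * norm (w - w'))"
    using C M by (intro mult_left_mono) auto
  with True show ?thesis by simp
next
  case big: False
  define S where "S = {x \<in> cball w' (norm (w - w')). norm (f x) \<le> C}"
  have sub: "cball w' (norm (w - w')) \<subseteq> ball w' R"
    using w by (auto simp: dist_norm norm_minus_commute)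
  have cont: "continuous_on (cball w' (norm (w - w'))) f"
    using holf sub by (meson continuous_on_subset holomorphic_on_imp_continuous_on)
  have "closed S"
  proof -
    have "S = cball w' (norm (w - w')) \<inter> f -` cball 0 C"
      by (auto simp: S_def)
    then show ?thesis
      using continuous_closed_preimage[OF cont closed_cball closed_cball, of 0 C] by (simp only:)
  qed
  moreover have "w \<in> S"
    using C by (simp add: S_def dist_norm norm_minus_commute)
  ultimately obtain x where x: "x \<in> S" and xmin: "\<And>y. y \<in> S \<Longrightarrow> dist w' x \<le> dist w' y"
    using distance_attains_inf[of S w'] by blast
  define r where "r = dist w' x"
  have xw: "norm (x - w') \<le> norm (w - w')" and fx: "norm (f x) \<le> C"
    using x by (auto simp: S_def dist_norm norm_minus_commute)
  then have xR: "x \<in> ball w' R"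
    using sub by (auto simp: dist_norm norm_minus_commute)
  have r: "r > 0"
    using big fx by (auto simp: r_def)
  have rR: "ball w' r \<subseteq> ball w' R"
    using xR by (auto simp: r_def)
  have gt: "norm (f z) > C" if "z \<in> ball w' r" for z
    using xmin[of z] that xw by (force simp: S_def r_def dist_norm norm_minus_commute)
  obtain h where h: "h holomorphic_on ball w' r" and fh: "\<And>z. z \<in> ball w' r \<Longrightarrow> f z / of_real C = exp (h z)"
  proof (rule log_on_ball[of "\<lambda>z. f z / of_real C" w' r])
    show "(\<lambda>z. f z / of_real C) holomorphic_on ball w' r"
      using C by (intro holomorphic_intros holomorphic_on_subset[OF holf rR]) auto
    show "\<And>z. z \<in> ball w' r \<Longrightarrow> f z / of_real C \<noteq> 0"
      using gt C by force
  qed blast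
  have norm_f: "norm (f z) = C * exp (Re (h z))" if "z \<in> ball w' r" for z
    using arg_cong[OF fh[OF that], of norm] C by (simp add: norm_divide field_simps)
  have hpos: "Re (h z) > 0" if "z \<in> ball w' r" for z
    using gt[OF that] C by (simp add: norm_f[OF that])
  define u where "u = Re (h w')"
  \<comment> \<open>approach \<open>x\<close> along the radius from \<open>w'\<close>\<close>
  define y where "y \<delta> = x + of_real \<delta> * (w' - x)" for \<delta> :: real
  have slope: "C * u / 2 \<le> norm ((f (y \<delta>) - f x) / (y \<delta> - x)) * r" if "0 < \<delta>" "\<delta> < 1" for \<delta>
  proof -
    have "y \<delta> - w' = of_real (1 - \<delta>) * (x - w')"
      by (simp add: y_def algebra_simps)
    then have ny: "norm (y \<delta> - w') = (1 - \<delta>) * r"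
      using that by (simp add: norm_mult r_def dist_norm norm_minus_commute del: of_real_diff)
    then have yb: "y \<delta> \<in> ball w' r"
      using that r by (simp add: dist_norm norm_minus_commute)
    have "u * (r - (1 - \<delta>) * r) \<le> Re (h (y \<delta>)) * (r + (1 - \<delta>) * r)"
      using half_plane_harnack[OF h hpos yb] by (simp add: u_def ny)
    also have "\<dots> \<le> Re (h (y \<delta>)) * (2 * r)"
      using hpos[OF yb] that r by (intro mult_left_mono) (auto simp: algebra_simps)
    finally have "r * (u * \<delta> / 2) \<le> r * Re (h (y \<delta>))"
      by (simp add: algebra_simps)
    then have "u * \<delta> / 2 \<le> Re (h (y \<delta>))"
      using r by simp
    then have "C * (1 + u * \<delta> / 2) \<le> norm (f (y \<delta>))"
      using C exp_ge_add_one_self[of "Re (h (y \<delta>))"] unfolding norm_f[OF yb]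
      by (intro mult_left_mono) linarith+
    then have "C * u / 2 * \<delta> \<le> norm (f (y \<delta>)) - norm (f x)"
      using fx by (simp add: algebra_simps)
    also have "\<dots> \<le> norm (f (y \<delta>) - f x)"
      by (rule norm_triangle_ineq2)
    finally have "C * u / 2 \<le> norm (f (y \<delta>) - f x) / \<delta>"
      using that by (simp add: pos_le_divide_eq)
    moreover have "norm (y \<delta> - x) = \<delta> * r"
      using that by (simp add: y_def norm_mult r_def dist_norm)
    ultimately show ?thesis
      using that r by (simp add: norm_divide)
  qed
  have "(f has_field_derivative deriv f x) (at x)"
    using holf xR by (intro holomorphic_derivI[of _ "ball w' R"]) auto
  then have "((\<lambda>z. (f z - f x) / (z - x)) \<longlongrightarrow> deriv f x) (at x)"
    by (simp add: has_field_derivative_iff)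
  moreover have "filterlim y (at x) (at_right 0)"
  proof (rule filterlim_atI)
    have "(y \<longlongrightarrow> x + of_real 0 * (w' - x)) (at_right 0)"
      unfolding y_def by (intro tendsto_intros)
    then show "(y \<longlongrightarrow> x) (at_right 0)" by simp
    have "eventually (\<lambda>\<delta>::real. \<delta> > 0) (at_right 0)"
      by (simp add: eventually_at_right_less)
    then show "eventually (\<lambda>\<delta>. y \<delta> \<noteq> x) (at_right 0)"
      by eventually_elim (use r in \<open>auto simp: y_def r_def\<close>)
  qed
  ultimately have "((\<lambda>\<delta>. (f (y \<delta>) - f x) / (y \<delta> - x)) \<longlongrightarrow> deriv f x) (at_right 0)"
    by (rule filterlim_compose)
  then have "((\<lambda>\<delta>. norm ((f (y \<delta>) - f x) / (y \<delta> - x)) * r) \<longlongrightarrow> norm (deriv f x) * r) (at_right 0)"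
    by (intro tendsto_intros)
  moreover have "eventually (\<lambda>\<delta>::real. 0 < \<delta> \<and> \<delta> < 1) (at_right 0)"
    using eventually_at_right_real[of 0 1] by (auto elim!: eventually_mono)
  then have "eventually (\<lambda>\<delta>. C * u / 2 \<le> norm ((f (y \<delta>) - f x) / (y \<delta> - x)) * r) (at_right 0)"
    by (rule eventually_mono) (simp only: slope)
  ultimately have "C * u / 2 \<le> norm (deriv f x) * r"
    by (intro tendsto_lowerbound) auto
  also have "\<dots> \<le> (M * (1 + C\<^sup>2)) * norm (w - w')"
  proof (intro mult_mono)
    have "M * (1 + (norm (f x))\<^sup>2) \<le> M * (1 + C\<^sup>2)"
      using M fx by (intro mult_left_mono add_left_mono power_mono) auto
    with sph[OF xR] show "norm (deriv f x) \<le> M * (1 + C\<^sup>2)" by linarith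
    show "r \<le> norm (w - w')" using xw by (simp add: r_def dist_norm norm_minus_commute)
  qed (use M r in auto)
  finally have "u \<le> 2 * (M * (1 + C\<^sup>2)) * norm (w - w') / C"
    using C by (simp add: field_simps)
  also have "\<dots> = 2 * M * (C + 1/C) * norm (w - w')"
    using C by (simp add: field_simps power2_eq_square)
  finally have "exp u \<le> exp (2 * M * (C + 1/C) * norm (w - w'))"
    by (simp only: exp_le_cancel_iff)
  then have "C * exp u \<le> C * exp (2 * M * (C + 1/C) * norm (w - w'))"
    using C by (intro mult_left_mono) auto
  moreover have "norm (f w') = C * exp u"
    using norm_f[of w'] r by (simp only: u_def centre_in_ball)
  ultimately show ?thesis by (simp only:)
qed

text \<open>
  If \<open>\<bar>f\<bar> > 1\<close> on the whole disc, then \<open>f = exp h\<close> with \<open>Re h > 0\<close>, and the derivative bound for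
  such \<open>h\<close> gives \<open>\<bar>f'\<bar> \<le> 2 * \<bar>f\<bar> * ln \<bar>f\<bar>\<close> at the centre, which is less than \<open>\<bar>f\<bar>\<^sup>2\<close>.
\<close>

lemma spherical_derivative_ge_one_imp_small_value:
  assumes f: "f holomorphic_on ball a 1" and d: "norm (deriv f a) \<ge> 1 + (norm (f a))\<^sup>2"
  obtains w where "w \<in> ball a 1" "norm (f w) \<le> 1"
proof (rule ccontr)
  assume "\<not> thesis"
  with that have gt: "norm (f z) > 1" if "z \<in> ball a 1" for z
    using that by force
  obtain h where h: "h holomorphic_on ball a 1" and fh: "\<And>z. z \<in> ball a 1 \<Longrightarrow> f z = exp (h z)"
    using log_on_ball[OF f] gt by (metis less_irrefl norm_zero not_one_less_zero)
  have hpos: "Re (h z) > 0" if "z \<in> ball a 1" for z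
    using gt[OF that] fh[OF that] by (simp add: norm_exp_eq_Re)
  have "(h has_field_derivative deriv h a) (at a)"
    using h by (intro holomorphic_derivI[of _ "ball a 1"]) auto
  then have "((\<lambda>z. exp (h z)) has_field_derivative exp (h a) * deriv h a) (at a)"
    by (rule DERIV_chain2[OF DERIV_exp])
  then have "(f has_field_derivative exp (h a) * deriv h a) (at a)"
    by (rule has_field_derivative_transform_within_open[of _ _ _ "ball a 1"]) (auto simp: fh)
  then have "deriv f a = f a * deriv h a"
    by (simp add: DERIV_imp_deriv fh)
  moreover have "norm (deriv h a) \<le> 2 * Re (h a)"
    using half_plane_deriv_bound[OF h hpos] by simp
  moreover have na: "norm (f a) = exp (Re (h a))"
    by (simp add: fh)
  ultimately have "norm (deriv f a) \<le> norm (f a) * (2 * Re (h a))"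
    by (simp add: norm_mult mult_left_mono)
  with d have "exp (Re (h a)) * exp (Re (h a)) < exp (Re (h a)) * (2 * Re (h a))"
    unfolding power2_eq_square na by linarith
  then have "exp (Re (h a)) < 2 * Re (h a)" by simp
  moreover have *: "exp (t::real) \<ge> 2 * t" if "t > 0" for t
    using exp_lower_Taylor_quadratic[of t] that sum_squares_ge_zero[of "t - 1" 0]
    by (simp add: power2_eq_square algebra_simps)
  ultimately show False using hpos[of a] *[of "Re (h a)"] by fastforce
qed

text \<open>
  The normalization at \<open>0\<close> produces a point of the unit disc where \<open>\<bar>g\<bar> \<le> 1\<close>. From there
  \<open>clunie_hayman_bound\<close> first bounds \<open>g 0\<close> and then, starting again at \<open>0\<close>, every other value. The
  bound does not depend on \<open>g\<close> or \<open>R\<close>: it makes rescaled functions locally bounded, and it makes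
  their limits functions of exponential type.
\<close>

lemma normalized_exponential_bound:
  assumes g: "g holomorphic_on ball 0 (2 * R)" and R: "R \<ge> 1"
    and sph: "\<And>z. z \<in> ball 0 (2 * R) \<Longrightarrow> norm (deriv g z) \<le> M * (1 + (norm (g z))\<^sup>2)"
    and g0: "norm (deriv g 0) \<ge> 1 + (norm (g 0))\<^sup>2" and M: "M \<ge> 0"
    and C: "C = exp (4 * M)" and z: "z \<in> ball 0 R"
  shows "norm (g z) \<le> C * exp (2 * M * (C + 1 / C) * norm z)"
proof -
  obtain w where w: "w \<in> ball 0 1" "norm (g w) \<le> 1"
    using spherical_derivative_ge_one_imp_small_value[of g 0] g g0 R
    by (metis holomorphic_on_subset mult_2 one_le_numeral order_trans subset_ball add_increasing2 zero_le_one)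
  have "norm (g 0) \<le> 1 * exp (2 * M * (1 + 1 / 1) * norm (w - 0))"
    by (rule clunie_hayman_bound[OF g M sph]) (use w R in auto)
  also have "\<dots> \<le> C"
    using w M by (simp add: C mult_left_le)
  finally have g0C: "norm (g 0) \<le> C" .
  have sub: "ball z R \<subseteq> ball 0 (2 * R)"
    using z by (intro ball_subset_ball_iff[THEN iffD2]) (auto simp: dist_norm)
  have "norm (g z) \<le> C * exp (2 * M * (C + 1 / C) * norm (0 - z))"
    by (rule clunie_hayman_bound[of g z R])
       (use sub sph g M g0C z in \<open>auto simp: C dist_norm intro: holomorphic_on_subset\<close>)
  then show ?thesis by simp
qed

section \<open>Spherical convergence\<close>

text \<open>
  A single \<open>d\<close> serves both the finite points and the neighbourhood of infinity, since half the chordal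
  distance is at most \<open>\<bar>z - w\<bar>\<close> between finite points and at most \<open>1 / \<bar>z\<bar>\<close> to infinity.
\<close>

lemma spherical_dist_small:
  assumes "e > 0"
  obtains d where "d > 0" "\<And>z w. norm (z - w) < d \<Longrightarrow> spherical_dist (Some z) (Some w) < e"
    and "\<And>z. norm z > 1 / d \<Longrightarrow> spherical_dist (Some z) None < e"
proof -
  have "isCont arcsin 0"
    by (rule isCont_arcsin) auto
  then have "((\<lambda>x. 2 * arcsin x) \<longlongrightarrow> 2 * arcsin 0) (at 0)"
    by (intro tendsto_intros) (simp add: isCont_def)
  then have "isCont (\<lambda>x. 2 * arcsin x) 0"
    by (simp add: isCont_def)
  then obtain d where d: "d > 0" "\<And>x. \<bar>x\<bar> < d \<Longrightarrow> \<bar>2 * arcsin x\<bar> < e"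
    using assms unfolding continuous_at_eps_delta by (force simp: dist_real_def)
  have sq: "sqrt (1 + (norm z)\<^sup>2) \<ge> 1" "sqrt (1 + (norm z)\<^sup>2) > norm z \<or> z = 0" for z :: complex
    by (auto intro!: real_less_rsqrt)
  show thesis
  proof (rule that[OF d(1)])
    fix z w :: complex assume zw: "norm (z - w) < d"
    have "1 * 1 \<le> sqrt (1 + (norm z)\<^sup>2) * sqrt (1 + (norm w)\<^sup>2)"
      by (intro mult_mono sq) auto
    then have "norm (z - w) / (sqrt (1 + (norm z)\<^sup>2) * sqrt (1 + (norm w)\<^sup>2)) \<le> norm (z - w) / 1"
      by (intro divide_left_mono) auto
    with zw have "\<bar>chordal_dist (Some z) (Some w) / 2\<bar> < d"
      by simp
    then show "spherical_dist (Some z) (Some w) < e"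
      unfolding spherical_dist_def by (smt (verit) d(2))
  next
    fix z :: complex assume z: "norm z > 1 / d"
    then have "norm z > 0" using d by (smt (verit) divide_pos_pos)
    then have "1 / sqrt (1 + (norm z)\<^sup>2) \<le> 1 / norm z"
      using sq(1,2)[of z] \<open>norm z > 0\<close> by (intro divide_left_mono mult_pos_pos) (auto intro: add_pos_nonneg)
    also have "1 / norm z < d"
      using z d \<open>norm z > 0\<close> by (simp add: field_simps)
    finally have "\<bar>chordal_dist (Some z) None / 2\<bar> < d"
      by simp
    then show "spherical_dist (Some z) None < e"
      unfolding spherical_dist_def by (smt (verit) d(2))
  qed
qed

lemma sphere_val_holomorphic:
  assumes "f holomorphic_on D" "open D" "z \<in> D"
  shows "sphere_val f z = Some (f z)"
  using not_is_pole_holomorphic[OF assms(2,3,1)] by (simp add: sphere_val_def)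

lemma uniform_limit_imp_spherical_limit:
  assumes "open D" and s: "\<And>m. s m holomorphic_on D" and g: "g holomorphic_on D"
    and lim: "\<And>K. compact K \<Longrightarrow> K \<subseteq> D \<Longrightarrow> uniform_limit K s g sequentially"
  shows "spherically_locally_uniform_limit D (\<lambda>m. sphere_val (s m)) (sphere_val g)"
  unfolding spherically_locally_uniform_limit_def
proof (intro allI impI)
  fix K and e :: real assume K: "compact K \<and> K \<subseteq> D" and e: "e > 0"
  obtain d where d: "d > 0" "\<And>z w. norm (z - w) < d \<Longrightarrow> spherical_dist (Some z) (Some w) < e"
    using spherical_dist_small[OF e] by metis
  have "\<forall>\<^sub>F m in sequentially. \<forall>z\<in>K. dist (s m z) (g z) < d"
    using lim K d(1) by (auto simp: uniform_limit_iff)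
  then show "\<forall>\<^sub>F m in sequentially. \<forall>z\<in>K. spherical_dist (sphere_val (s m) z) (sphere_val g z) < e"
  proof eventually_elim
    case (elim m)
    show ?case
    proof
      fix z assume z: "z \<in> K"
      with K have zD: "z \<in> D" by auto
      have "norm (s m z - g z) < d"
        using elim z by (simp add: dist_norm)
      then show "spherical_dist (sphere_val (s m) z) (sphere_val g z) < e"
        using d(2) by (simp add: sphere_val_holomorphic[OF s \<open>open D\<close> zD] sphere_val_holomorphic[OF g \<open>open D\<close> zD])
    qed
  qed
qed

lemma uniform_to_infinity_imp_spherical_limit:
  assumes "open D" and s: "\<And>m. s m holomorphic_on D"
    and lim: "\<And>K B. compact K \<Longrightarrow> K \<subseteq> D \<Longrightarrow> \<forall>\<^sub>F m in sequentially. \<forall>z\<in>K. B < norm (s m z)"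
  shows "spherically_locally_uniform_limit D (\<lambda>m. sphere_val (s m)) (\<lambda>_. None)"
  unfolding spherically_locally_uniform_limit_def
proof (intro allI impI)
  fix K and e :: real assume K: "compact K \<and> K \<subseteq> D" and e: "e > 0"
  obtain d where d: "d > 0" "\<And>z. norm z > 1 / d \<Longrightarrow> spherical_dist (Some z) None < e"
    using spherical_dist_small[OF e] by metis
  have "\<forall>\<^sub>F m in sequentially. \<forall>z\<in>K. 1 / d < norm (s m z)"
    using lim K by blast
  then show "\<forall>\<^sub>F m in sequentially. \<forall>z\<in>K. spherical_dist (sphere_val (s m) z) None < e"
  proof eventually_elim
    case (elim m)
    then show ?case
      using d(2) K by (auto simp: sphere_val_holomorphic[OF s \<open>open D\<close>])
  qed
qed

section \<open>Bounded spherical derivatives imply normality\<close>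

definition spherical_deriv_bounded_near :: "(complex \<Rightarrow> complex) set \<Rightarrow> complex \<Rightarrow> bool" where
  "spherical_deriv_bounded_near \<F> a \<longleftrightarrow>
     (\<exists>r>0. \<exists>M\<ge>0. \<forall>f\<in>\<F>. \<forall>z\<in>ball a r. norm (deriv f z) \<le> M * (1 + (norm (f z))\<^sup>2))"

text \<open>
  The bound makes boundedness of a sequence at a point both an open and a closed condition, and it
  makes divergence to infinity at a point uniform near that point.
\<close>

lemma bound_spreads:
  assumes "open D" "a \<in> D" "\<And>f. f \<in> \<F> \<Longrightarrow> f holomorphic_on D"
    and "spherical_deriv_bounded_near \<F> a"
  obtains d where "d > 0" "ball a d \<subseteq> D"
    "\<And>C. C > 0 \<Longrightarrow> \<exists>C'>0. \<forall>f\<in>\<F>. \<forall>w\<in>ball a d. \<forall>w'\<in>ball a d. norm (f w) \<le> C \<longrightarrow> norm (f w') \<le> C'"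
proof -
  obtain r1 where r1: "r1 > 0" "ball a r1 \<subseteq> D"
    using assms(1,2) openE by blast
  obtain r2 M where r2: "r2 > 0" "M \<ge> 0"
    and M: "\<And>f z. f \<in> \<F> \<Longrightarrow> z \<in> ball a r2 \<Longrightarrow> norm (deriv f z) \<le> M * (1 + (norm (f z))\<^sup>2)"
    using assms(4) unfolding spherical_deriv_bounded_near_def by metis
  define d where "d = min r1 r2 / 4"
  have d: "d > 0" "4 * d \<le> r1" "4 * d \<le> r2"
    using r1 r2 by (auto simp: d_def)
  show thesis
  proof (rule that[OF d(1)])
    show "ball a d \<subseteq> D"
      using r1(2) d by (auto simp: subset_iff)
    fix C :: real assume C: "C > 0"
    define C' where "C' = C * exp (2 * M * (C + 1/C) * (2 * d))"
    have "norm (f w') \<le> C'" if f: "f \<in> \<F>" and w: "w \<in> ball a d" "w' \<in> ball a d" "norm (f w) \<le> C" for f w w'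
    proof -
      have sub: "ball w' (2 * d) \<subseteq> ball a (3 * d)"
        using w(2) by (intro ball_subset_ball_iff[THEN iffD2]) (auto simp: dist_commute)
      have ww: "dist w w' < 2 * d"
        using w dist_triangle_less_add[of w a d w' d] by (simp add: dist_commute)
      have "norm (f w') \<le> C * exp (2 * M * (C + 1/C) * norm (w - w'))"
      proof (rule clunie_hayman_bound[of f w' "2 * d"])
        show "f holomorphic_on ball w' (2 * d)"
          using assms(3)[OF f] by (rule holomorphic_on_subset) (use sub r1(2) d in \<open>force simp: subset_iff\<close>)
        show "w \<in> ball w' (2 * d)"
          using ww by (simp add: dist_commute)
        show "norm (deriv f z) \<le> M * (1 + (norm (f z))\<^sup>2)" if "z \<in> ball w' (2 * d)" for z
          using M[OF f, of z] that sub d by (force simp: subset_iff)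
      qed (use r2 C w in auto)
      also have "\<dots> \<le> C'"
        unfolding C'_def
        using C r2 ww by (intro mult_left_mono exp_le_cancel_iff[THEN iffD2]) (auto simp: dist_norm)
      finally show ?thesis .
    qed
    then show "\<exists>C'>0. \<forall>f\<in>\<F>. \<forall>w\<in>ball a d. \<forall>w'\<in>ball a d. norm (f w) \<le> C \<longrightarrow> norm (f w') \<le> C'"
      using C by (intro exI[of _ C']) (auto simp: C'_def)
  qed
qed

text \<open>
  If the sequence tends to infinity at every point, it does so uniformly on compact sets.
  Otherwise some subsequence is bounded at one point, hence at all points because \<open>D\<close> is
  connected, hence locally bounded, and Montel applies to it.
\<close>

lemma marty_imp_normal_family:
  assumes D: "open D" "connected D" and hol: "\<And>f. f \<in> \<F> \<Longrightarrow> f holomorphic_on D"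
    and bdd: "\<And>a. a \<in> D \<Longrightarrow> spherical_deriv_bounded_near \<F> a"
  shows "normal_family \<F> D"
  unfolding normal_family_def
proof (intro allI impI)
  fix s :: "nat \<Rightarrow> complex \<Rightarrow> complex" assume s: "range s \<subseteq> \<F>"
  then have sF: "s m \<in> \<F>" for m by auto
  have "\<forall>a\<in>D. \<exists>d>0. ball a d \<subseteq> D \<and> (\<forall>C>0. \<exists>C'>0. \<forall>f\<in>\<F>. \<forall>w\<in>ball a d. \<forall>w'\<in>ball a d. norm (f w) \<le> C \<longrightarrow> norm (f w') \<le> C')"
    using bound_spreads[OF D(1) _ hol bdd] by metis
  then obtain \<delta> where \<delta>: "\<And>a. a \<in> D \<Longrightarrow> \<delta> a > 0" "\<And>a. a \<in> D \<Longrightarrow> ball a (\<delta> a) \<subseteq> D"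
    and "\<forall>a C. a \<in> D \<longrightarrow> C > 0 \<longrightarrow> (\<exists>C'>0. \<forall>f\<in>\<F>. \<forall>w\<in>ball a (\<delta> a). \<forall>w'\<in>ball a (\<delta> a). norm (f w) \<le> C \<longrightarrow> norm (f w') \<le> C')"
    by metis
  \<comment> \<open>a bound \<open>C\<close> at one point of the disc of radius \<open>\<delta> a\<close> spreads to the bound \<open>\<beta> a C\<close> on all of it\<close>
  then obtain \<beta> where \<beta>: "\<And>a C f w w'. \<lbrakk>a \<in> D; C > 0; f \<in> \<F>; w \<in> ball a (\<delta> a); w' \<in> ball a (\<delta> a); norm (f w) \<le> C\<rbrakk>
        \<Longrightarrow> norm (f w') \<le> \<beta> a C" and \<beta>pos: "\<And>a C. a \<in> D \<Longrightarrow> C > 0 \<Longrightarrow> \<beta> a C > 0"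
    by metis
  have cover: "\<exists>A. finite A \<and> A \<subseteq> K \<and> K \<subseteq> (\<Union>a\<in>A. ball a (\<delta> a))" if K: "compact K" "K \<subseteq> D" for K
  proof -
    have "K \<subseteq> (\<Union>a\<in>K. ball a (\<delta> a))" 
      using \<delta>(1) K by force
    then obtain A where "A \<subseteq> K" "finite A" "K \<subseteq> (\<Union>a\<in>A. ball a (\<delta> a))"
      using compactE_image[OF K(1), of K "\<lambda>a. ball a (\<delta> a)"] by auto
    then show ?thesis by blast
  qed
  show "\<exists>r. strict_mono r \<and>
         ((\<exists>g. g nicely_meromorphic_on D \<and>
               spherically_locally_uniform_limit D (\<lambda>m. sphere_val (s (r m))) (sphere_val g)) \<or>
          spherically_locally_uniform_limit D (\<lambda>m. sphere_val (s (r m))) (\<lambda>_. None))"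
  proof (cases "\<exists>a\<in>D. \<exists>C. \<exists>\<^sub>\<infinity>m. norm (s m a) \<le> C")
    case True
    then obtain a C where a: "a \<in> D" and inf: "\<exists>\<^sub>\<infinity>m. norm (s m a) \<le> C" by blast
    have "infinite {m. norm (s m a) \<le> C}"
      using inf by (simp add: INFM_iff_infinite)
    from infinite_enumerate[OF this]
    obtain r where r: "strict_mono (r :: nat \<Rightarrow> nat)" and "\<forall>n. r n \<in> {m. norm (s m a) \<le> C}"
      by blast
    then have rC: "norm (s (r m) a) \<le> C" for m
      by simp
    define S where "S = {z \<in> D. \<exists>C>0. \<forall>m. norm (s (r m) z) \<le> C}"
    have near: "w' \<in> S" if "b \<in> D" "w \<in> ball b (\<delta> b)" "w' \<in> ball b (\<delta> b)" "w \<in> S" for b w w'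
    proof -
      obtain C where "C > 0" "\<And>m. norm (s (r m) w) \<le> C"
        using \<open>w \<in> S\<close> by (auto simp: S_def)
      then have "\<forall>m. norm (s (r m) w') \<le> \<beta> b C"
        using \<beta>[OF that(1) _ sF that(2,3)] by blast
      then show ?thesis
        using \<delta>(2)[OF that(1)] that(3) \<beta>pos[OF that(1) \<open>C > 0\<close>] by (auto simp: S_def)
    qed
    have "S = D"
    proof (rule ccontr)
      assume ne: "S \<noteq> D"
      have SD: "S \<subseteq> D" by (auto simp: S_def)
      have "open S"
        unfolding open_contains_ball
        using near \<delta>(1) SD by (metis centre_in_ball subset_iff)
      moreover have "open (D - S)"
        unfolding open_contains_ball
      proof
        fix b assume b: "b \<in> D - S"
        then show "\<exists>e>0. ball b e \<subseteq> D - S"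
          using near[of b _ b] \<delta>[of b] by (intro exI[of _ "\<delta> b"]) auto
      qed
      moreover have "a \<in> S"
        using a rC by (auto simp: S_def intro!: exI[of _ "max C 1"] max.coboundedI1)
      ultimately show False
        using D(2) ne SD connectedD[of D S "D - S"] by blast
    qed
    have bd: "\<exists>B. \<forall>h \<in> range (s \<circ> r). \<forall>z\<in>K. norm (h z) \<le> B" if K: "compact K" "K \<subseteq> D" for K
    proof -
      obtain A where A: "finite A" "A \<subseteq> K" "K \<subseteq> (\<Union>a\<in>A. ball a (\<delta> a))"
        using cover[OF K] by blast
      have "\<forall>b\<in>A. \<exists>B>0. \<forall>m. norm (s (r m) b) \<le> B"
        using A(2) K(2) unfolding \<open>S = D\<close>[symmetric] by (auto simp: S_def)
      then obtain B where B: "\<And>b m. b \<in> A \<Longrightarrow> norm (s (r m) b) \<le> B b" "\<And>b. b \<in> A \<Longrightarrow> B b > 0"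
        by metis
      have "norm (s (r m) z) \<le> (\<Sum>b\<in>A. \<beta> b (B b))" if z: "z \<in> K" for z m
      proof -
        obtain b where b: "b \<in> A" "z \<in> ball b (\<delta> b)"
          using A(3) z by blast
        then have bD: "b \<in> D" using A K by auto
        have "norm (s (r m) z) \<le> \<beta> b (B b)"
          using \<beta>[OF bD B(2)[OF b(1)] sF _ b(2) B(1)[OF b(1)]] \<delta>(1)[OF bD] by simp
        also have "\<dots> \<le> (\<Sum>b\<in>A. \<beta> b (B b))"
          using A K B(2) \<beta>pos by (intro member_le_sum b) (auto intro!: less_imp_le)
        finally show ?thesis .
      qed
      then show ?thesis by (intro exI[of _ "\<Sum>b\<in>A. \<beta> b (B b)"]) auto
    qed
    have hr: "h holomorphic_on D" if "h \<in> range (s \<circ> r)" for h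
      using that hol[OF sF] by auto
    obtain g k where g: "g holomorphic_on D" and k: "strict_mono k"
      and lim: "\<And>K. compact K \<Longrightarrow> K \<subseteq> D \<Longrightarrow> uniform_limit K ((s \<circ> r) \<circ> k) g sequentially"
    proof (rule Montel[OF D(1), of "range (s \<circ> r)" "s \<circ> r"])
      fix g k assume "g holomorphic_on D" "strict_mono (k :: nat \<Rightarrow> nat)"
        "\<And>K. compact K \<Longrightarrow> K \<subseteq> D \<Longrightarrow> uniform_limit K ((s \<circ> r) \<circ> k) g sequentially"
      then show thesis by (rule that)
    qed (erule hr | erule (1) bd | rule order_refl)+
    have "spherically_locally_uniform_limit D (\<lambda>m. sphere_val (s ((r \<circ> k) m))) (sphere_val g)"
      using lim by (intro uniform_limit_imp_spherical_limit D hol sF g) (simp add: o_def)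
    moreover have "g nicely_meromorphic_on D"
      using g D(1) by (simp add: analytic_on_imp_nicely_meromorphic_on analytic_on_open)
    ultimately show ?thesis
      using strict_mono_o[OF r k] by blast
  next
    case False
    have "\<forall>\<^sub>F m in sequentially. \<forall>z\<in>K. B < norm (s m z)" if K: "compact K" "K \<subseteq> D" for K B
    proof -
      obtain A where A: "finite A" "A \<subseteq> K" "K \<subseteq> (\<Union>a\<in>A. ball a (\<delta> a))"
        using cover[OF K] by blast
      define B' where "B' = max B 1"
      have "\<forall>\<^sub>F m in sequentially. norm (s m a) > \<beta> a B'" if "a \<in> A" for a
      proof -
        have "a \<in> D" using that A K by auto
        then have "\<not> (\<exists>\<^sub>\<infinity>m. norm (s m a) \<le> \<beta> a B')"
          using False by blast
        then show ?thesis
          by (simp add: not_frequently not_le cofinite_eq_sequentially)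
      qed
      then have "\<forall>\<^sub>F m in sequentially. \<forall>a\<in>A. norm (s m a) > \<beta> a B'"
        using A(1) by (simp add: eventually_ball_finite)
      then show ?thesis
      proof eventually_elim
        case (elim m)
        show ?case
        proof
          fix z assume "z \<in> K"
          then obtain a where a: "a \<in> A" "z \<in> ball a (\<delta> a)"
            using A(3) by blast
          have aD: "a \<in> D" using a A K by auto
          have "\<not> norm (s m z) \<le> B'"
            using \<beta>[OF aD _ sF a(2), of B' a m] elim a(1) \<delta>(1)[OF aD] by (force simp: B'_def)
          then show "B < norm (s m z)" by (simp add: B'_def)
        qed
      qed
    qed
    then have "spherically_locally_uniform_limit D (\<lambda>m. sphere_val (s m)) (\<lambda>_. None)"
      by (intro uniform_to_infinity_imp_spherical_limit D hol sF) auto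
    then show ?thesis
      using strict_mono_id by (intro exI[of _ id]) auto
  qed
qed

section \<open>Locally uniform convergence to entire functions on growing discs\<close>

text \<open>
  The functions \<open>h m\<close> need only be holomorphic on discs that eventually exhaust the plane, which is
  the situation after rescaling; each \<open>h m\<close> is an arbitrary total function outside its disc.
\<close>

definition entire_limit :: "(nat \<Rightarrow> complex \<Rightarrow> complex) \<Rightarrow> (complex \<Rightarrow> complex) \<Rightarrow> bool" where
  "entire_limit h g \<longleftrightarrow> g holomorphic_on UNIV \<and>
     (\<forall>R. (\<forall>\<^sub>F m in sequentially. h m holomorphic_on ball 0 R) \<and> uniform_limit (ball 0 R) h g sequentially)"

lemma entire_limit_holomorphic: "entire_limit h g \<Longrightarrow> g holomorphic_on A"
  by (auto simp: entire_limit_def intro: holomorphic_on_subset)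

lemma entire_limit_const: "entire_limit (\<lambda>m z. c) (\<lambda>z. c)"
  by (auto simp: entire_limit_def intro!: uniform_limit_intros)

lemma entire_limit_mult:
  assumes "entire_limit h g" "entire_limit h' g'"
  shows "entire_limit (\<lambda>m z. h m z * h' m z) (\<lambda>z. g z * g' z)"
  unfolding entire_limit_def
proof (intro conjI allI)
  show "(\<lambda>z. g z * g' z) holomorphic_on UNIV"
    using assms by (intro holomorphic_intros entire_limit_holomorphic)
  fix R
  have "\<forall>\<^sub>F m in sequentially. h m holomorphic_on ball 0 R" "\<forall>\<^sub>F m in sequentially. h' m holomorphic_on ball 0 R"
    using assms by (auto simp: entire_limit_def)
  then show "\<forall>\<^sub>F m in sequentially. (\<lambda>z. h m z * h' m z) holomorphic_on ball 0 R"
    by eventually_elim (intro holomorphic_intros)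
  have bdd: "bounded (k ` ball 0 R)" if "k holomorphic_on UNIV" for k :: "complex \<Rightarrow> complex"
  proof -
    have "continuous_on (cball 0 R) k"
      using that by (meson holomorphic_on_imp_continuous_on holomorphic_on_subset subset_UNIV)
    then have "bounded (k ` cball 0 R)"
      by (intro compact_imp_bounded compact_continuous_image) auto
    then show ?thesis
      by (rule bounded_subset) (auto intro!: image_mono)
  qed
  show "uniform_limit (ball 0 R) (\<lambda>m z. h m z * h' m z) (\<lambda>z. g z * g' z) sequentially"
    using assms by (intro uniform_lim_mult bdd) (auto simp: entire_limit_def)
qed

lemma entire_limit_power:
  assumes "entire_limit h g"
  shows "entire_limit (\<lambda>m z. h m z ^ n) (\<lambda>z. g z ^ n)"
  by (induction n) (simp_all add: entire_limit_const entire_limit_mult assms)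

lemma entire_limit_prod:
  assumes "\<And>j. j \<in> J \<Longrightarrow> entire_limit (h j) (g j)"
  shows "entire_limit (\<lambda>m z. \<Prod>j\<in>J. h j m z) (\<lambda>z. \<Prod>j\<in>J. g j z)"
  using assms by (induction J rule: infinite_finite_induct) (simp_all add: entire_limit_const entire_limit_mult)

text \<open>
  Cauchy's estimate on discs of radius \<open>1\<close> bounds the derivative of \<open>h m - g\<close> on a disc by the
  supremum of \<open>h m - g\<close> on a larger one.
\<close>

lemma entire_limit_deriv:
  assumes "entire_limit h g"
  shows "entire_limit (\<lambda>m. deriv (h m)) (deriv g)"
  unfolding entire_limit_def
proof (intro conjI allI)
  have g: "g holomorphic_on UNIV" using assms by (rule entire_limit_holomorphic)
  then show "deriv g holomorphic_on UNIV"
    by (intro holomorphic_deriv) auto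
  fix R
  have "\<forall>\<^sub>F m in sequentially. h m holomorphic_on ball 0 R"
    using assms by (auto simp: entire_limit_def)
  then show "\<forall>\<^sub>F m in sequentially. deriv (h m) holomorphic_on ball 0 R"
    by eventually_elim (intro holomorphic_deriv, auto)
  show "uniform_limit (ball 0 R) (\<lambda>m. deriv (h m)) (deriv g) sequentially"
  proof (rule uniform_limitI)
    fix e :: real assume e: "e > 0"
    have "\<forall>\<^sub>F m in sequentially. h m holomorphic_on ball 0 (R + 2)"
      and "\<forall>\<^sub>F m in sequentially. \<forall>z\<in>ball 0 (R + 2). dist (h m z) (g z) < e / 2"
      using assms half_gt_zero[OF e] unfolding entire_limit_def uniform_limit_iff by blast+
    then show "\<forall>\<^sub>F m in sequentially. \<forall>z\<in>ball 0 R. dist (deriv (h m) z) (deriv g z) < e"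
    proof eventually_elim
      case (elim m)
      show ?case
      proof
        fix z :: complex assume z: "z \<in> ball 0 R"
        have sub: "cball z 1 \<subseteq> ball 0 (R + 2)"
          using z by (intro cball_subset_ball_iff[THEN iffD2]) (auto simp: dist_norm)
        have hol: "(\<lambda>w. h m w - g w) holomorphic_on cball z 1"
          using elim(1) g by (auto intro!: holomorphic_intros intro: holomorphic_on_subset[OF _ sub] holomorphic_on_subset)
        have "norm ((deriv ^^ 1) (\<lambda>w. h m w - g w) z) \<le> fact 1 * (e / 2) / 1 ^ 1"
        proof (rule Cauchy_higher_deriv_bound[where y = 0])
          show "(\<lambda>w. h m w - g w) holomorphic_on ball z 1"
            using hol by (rule holomorphic_on_subset) auto
          show "continuous_on (cball z 1) (\<lambda>w. h m w - g w)"
            using hol by (rule holomorphic_on_imp_continuous_on)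
          show "h m w - g w \<in> ball 0 (e / 2)" if "w \<in> ball z 1" for w
          proof -
            have "w \<in> ball 0 (R + 2)" using that sub ball_subset_cball by blast
            then show ?thesis
              using elim(2) by (auto simp: dist_norm norm_minus_commute)
          qed
        qed auto
        also have "(deriv ^^ 1) (\<lambda>w. h m w - g w) z = deriv (h m) z - deriv g z"
        proof -
          have "z \<in> ball 0 (R + 2)" using z by auto
          then have "h m field_differentiable at z" "g field_differentiable at z"
            using elim(1) g by (auto intro: holomorphic_on_imp_differentiable_at)
          then show ?thesis by (simp add: deriv_diff)
        qed
        finally show "dist (deriv (h m) z) (deriv g z) < e"
          using e by (simp add: dist_norm)
      qed
    qed
  qed
qed

lemma entire_limit_higher_deriv:
  assumes "entire_limit h g"
  shows "entire_limit (\<lambda>m. (deriv ^^ t) (h m)) ((deriv ^^ t) g)"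
  by (induction t) (simp_all add: assms entire_limit_deriv)

lemma entire_limit_diff_monomial:
  assumes "entire_limit h g"
  shows "entire_limit (\<lambda>m. diff_monomial n k ns ts (h m)) (diff_monomial n k ns ts g)"
  unfolding diff_monomial_def
  by (intro entire_limit_mult entire_limit_power entire_limit_prod entire_limit_higher_deriv assms)

lemma entire_limit_tendsto:
  assumes "entire_limit h g"
  shows "(\<lambda>m. h m z) \<longlonglongrightarrow> g z"
proof -
  have "uniform_limit (ball 0 (norm z + 1)) h g sequentially"
    using assms by (auto simp: entire_limit_def)
  then show ?thesis
    by (rule tendsto_uniform_limitI) auto
qed

lemma entire_limit_hurwitz:
  assumes lim: "entire_limit h g" and z: "g z = p" and nc: "\<not> g constant_on UNIV" and e: "e > 0"
  shows "\<forall>\<^sub>F m in sequentially. \<exists>w\<in>ball z e. h m w = p"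
proof (rule ccontr)
  assume "\<not> ?thesis"
  then have inf: "\<exists>\<^sub>F m in sequentially. \<forall>w\<in>ball z e. h m w \<noteq> p"
    by (simp add: not_eventually)
  define R where "R = norm z + e"
  have sub: "ball z e \<subseteq> ball 0 R"
    by (intro ball_subset_ball_iff[THEN iffD2]) (auto simp: dist_norm R_def)
  have "\<forall>\<^sub>F m in sequentially. h m holomorphic_on ball 0 R"
    using lim by (auto simp: entire_limit_def)
  from frequently_eventually_frequently[OF inf this]
  have "infinite {m. (\<forall>w\<in>ball z e. h m w \<noteq> p) \<and> h m holomorphic_on ball 0 R}"
    by (simp add: frequently_cofinite flip: cofinite_eq_sequentially)
  from infinite_enumerate[OF this]
  obtain r where r: "strict_mono (r :: nat \<Rightarrow> nat)"
    and "\<forall>m. r m \<in> {m. (\<forall>w\<in>ball z e. h m w \<noteq> p) \<and> h m holomorphic_on ball 0 R}"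
    by blast
  then have rp: "\<And>m w. w \<in> ball z e \<Longrightarrow> h (r m) w \<noteq> p"
    and rh: "\<And>m. h (r m) holomorphic_on ball 0 R"
    by auto
  have g: "g holomorphic_on UNIV" using lim by (rule entire_limit_holomorphic)
  have "g z - p \<noteq> 0"
  proof (rule Hurwitz_no_zeros[of "ball z e" "\<lambda>m w. h (r m) w - p" "\<lambda>w. g w - p"])
    show "(\<lambda>w. h (r m) w - p) holomorphic_on ball z e" for m
      using holomorphic_on_subset[OF rh sub] by (intro holomorphic_intros)
    show "(\<lambda>w. g w - p) holomorphic_on ball z e"
      using lim by (intro holomorphic_intros entire_limit_holomorphic)
    show "uniform_limit K (\<lambda>m w. h (r m) w - p) (\<lambda>w. g w - p) sequentially" if "compact K" "K \<subseteq> ball z e" for K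
    proof -
      have "uniform_limit (ball 0 R) h g sequentially"
        using lim by (auto simp: entire_limit_def)
      then have "uniform_limit K h g sequentially"
        by (rule uniform_limit_on_subset) (use that sub in auto)
      then have "uniform_limit K (\<lambda>m. h (r m)) g sequentially"
        by (rule filterlim_compose[OF _ filterlim_subseq[OF r]])
      then show ?thesis
        by (intro uniform_limit_intros)
    qed
    show "\<not> (\<lambda>w. g w - p) constant_on ball z e"
    proof
      assume "(\<lambda>w. g w - p) constant_on ball z e"
      then have gc: "g w = p" if "w \<in> ball z e" for w
        using that z e unfolding constant_on_def by (metis centre_in_ball diff_eq_diff_eq right_minus_eq)
      have "g w = p" for w
        using analytic_continuation_open[of "ball z e" UNIV g "\<lambda>_. p" w] gc e g by auto
      then show False using nc by (auto simp: constant_on_def)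
    qed
  qed (use rp e in auto)
  with z show False by simp
qed

text \<open>
  Montel on each fixed disc, followed by a diagonal argument. The auxiliary functions \<open>H i m\<close> replace
  the finitely many \<open>h m\<close> that may fail to be holomorphic on the \<open>i\<close>-th disc by \<open>0\<close>, so that Montel applies to
  every sequence of indices, as the diagonalization requires.
\<close>

lemma montel_growing_discs:
  assumes h: "\<And>m. h m holomorphic_on ball 0 (real m)"
    and B: "\<And>m z. z \<in> ball 0 (real m) \<Longrightarrow> norm (h m z) \<le> B (norm z)" and mono: "mono B"
  obtains k g where "strict_mono (k :: nat \<Rightarrow> nat)" "entire_limit (\<lambda>m. h (k m)) g"
proof -
  define H where "H i m = (if m \<ge> Suc i then h m else (\<lambda>_. 0))" for i m
  have Hhol: "H i m holomorphic_on ball 0 (real (Suc i))" for i m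
    using holomorphic_on_subset[OF h, of "ball 0 (real (Suc i))" m] by (auto simp: H_def subset_ball)
  have B0: "norm (H i m z) \<le> \<bar>B (real (Suc i))\<bar>" if "z \<in> ball 0 (real (Suc i))" for i m z
  proof (cases "m \<ge> Suc i")
    case True
    then have "norm (h m z) \<le> B (norm z)" using that by (intro B) auto
    also have "\<dots> \<le> B (real (Suc i))"
      using that by (intro monoD[OF mono]) auto
    finally show ?thesis using True by (simp add: H_def)
  qed (simp add: H_def)
  define P where "P i (r :: nat \<Rightarrow> nat) \<longleftrightarrow> (\<exists>g. uniform_limit (cball 0 (real i)) (\<lambda>m. H i (r m)) g sequentially)" for i r
  obtain k where k: "strict_mono (k :: nat \<Rightarrow> nat)" "\<And>i. P i (id \<circ> k)"
  proof (rule subsequence_diagonalization_lemma[of P id])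
    fix i and r :: "nat \<Rightarrow> nat"
    have Hr: "f holomorphic_on ball 0 (real (Suc i))" if "f \<in> range (H i)" for f
      using that Hhol by auto
    have bdd: "\<exists>B. \<forall>f\<in>range (H i). \<forall>z\<in>K. norm (f z) \<le> B" if "K \<subseteq> ball 0 (real (Suc i))" for K
      using B0 that by (intro exI[of _ "\<bar>B (real (Suc i))\<bar>"]) blast
    have rng: "range (\<lambda>m. H i (r m)) \<subseteq> range (H i)" by auto
    obtain g k where k: "strict_mono (k :: nat \<Rightarrow> nat)"
      and lim: "\<And>K. compact K \<Longrightarrow> K \<subseteq> ball 0 (real (Suc i)) \<Longrightarrow> uniform_limit K ((\<lambda>m. H i (r m)) \<circ> k) g sequentially"
    proof (rule Montel[OF open_ball, of "range (H i)" 0 "real (Suc i)" "\<lambda>m. H i (r m)"])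
      fix g k assume "strict_mono (k :: nat \<Rightarrow> nat)"
        "\<And>K. compact K \<Longrightarrow> K \<subseteq> ball 0 (real (Suc i)) \<Longrightarrow> uniform_limit K ((\<lambda>m. H i (r m)) \<circ> k) g sequentially"
      then show thesis by (rule that)
    qed (erule Hr | erule bdd | rule rng)+
    have "uniform_limit (cball 0 (real i)) ((\<lambda>m. H i (r m)) \<circ> k) g sequentially"
      by (rule lim) auto
    with k show "\<exists>k. strict_mono (k :: nat \<Rightarrow> nat) \<and> P i (r \<circ> k)"
      by (auto simp: P_def o_def)
  next
    fix i and r k1 k2 :: "nat \<Rightarrow> nat" and N
    assume P: "P i (r \<circ> k1)" and sub: "\<And>j. N \<le> j \<Longrightarrow> \<exists>j'. j \<le> j' \<and> k2 j = k1 j'"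
    then obtain g where g: "uniform_limit (cball 0 (real i)) (\<lambda>m. H i (r (k1 m))) g sequentially"
      by (auto simp: P_def)
    have "uniform_limit (cball 0 (real i)) (\<lambda>m. H i (r (k2 m))) g sequentially"
    proof (rule uniform_limitI)
      fix e :: real assume "e > 0"
      then obtain M where "\<And>n. n \<ge> M \<Longrightarrow> \<forall>x\<in>cball 0 (real i). dist (H i (r (k1 n)) x) (g x) < e"
        using g by (auto simp: uniform_limit_iff eventually_sequentially)
      then have "\<forall>x\<in>cball 0 (real i). dist (H i (r (k2 n)) x) (g x) < e" if "n \<ge> max M N" for n
        using sub[of n] that by (metis max.boundedE order_trans)
      then show "\<forall>\<^sub>F n in sequentially. \<forall>x\<in>cball 0 (real i). dist (H i (r (k2 n)) x) (g x) < e"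
        unfolding eventually_sequentially by blast
    qed
    then show "P i (r \<circ> k2)"
      by (auto simp: P_def)
  qed blast
  have k_ge: "k m \<ge> m" for m
    using seq_suble[OF k(1)] .
  have ex: "\<exists>g. uniform_limit (cball 0 (real i)) (\<lambda>m. h (k m)) g sequentially" for i
  proof -
    obtain g where g: "uniform_limit (cball 0 (real i)) (\<lambda>m. H i (k m)) g sequentially"
      using k(2)[of i] by (auto simp: P_def)
    have "\<forall>\<^sub>F m in sequentially. \<forall>x\<in>cball 0 (real i). H i (k m) x = h (k m) x"
      using eventually_ge_at_top[of "Suc i"]
      by eventually_elim (use k_ge in \<open>auto simp: H_def intro: order_trans\<close>)
    from uniform_limit_cong[OF this refl, of g] g show ?thesis
      by blast
  qed
  define g where "g z = lim (\<lambda>m. h (k m) z)" for z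
  have ul: "uniform_limit (cball 0 (real i)) (\<lambda>m. h (k m)) g sequentially" for i
  proof -
    obtain g' where g': "uniform_limit (cball 0 (real i)) (\<lambda>m. h (k m)) g' sequentially"
      using ex by blast
    have "g z = g' z" if "z \<in> cball 0 (real i)" for z
      using tendsto_uniform_limitI[OF g' that] by (simp add: g_def limI)
    then show ?thesis
      using g' by (subst uniform_limit_cong'[of _ _ _ g g']) auto
  qed
  have evh: "\<forall>\<^sub>F m in sequentially. h (k m) holomorphic_on cball 0 (real i)" for i
    using eventually_ge_at_top[of "Suc i"]
  proof eventually_elim
    case (elim m)
    have "cball 0 (real i) \<subseteq> ball 0 (real (k m))"
      using elim k_ge[of m] by auto
    then show ?case using h by (rule holomorphic_on_subset[rotated])
  qed
  have "g holomorphic_on ball 0 (real i)" for i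
  proof -
    have "\<forall>\<^sub>F m in sequentially. continuous_on (cball 0 (real i)) (h (k m)) \<and> h (k m) holomorphic_on ball 0 (real i)"
      using evh[of i] by eventually_elim (auto intro: holomorphic_on_imp_continuous_on holomorphic_on_subset)
    then show ?thesis
      using holomorphic_uniform_limit[OF _ ul[of i]] by auto
  qed
  then have gd: "g field_differentiable at z" if "norm z < real i" for z i
    using that by (intro holomorphic_on_imp_differentiable_at[of g "ball 0 (real i)"]) auto
  have "g field_differentiable at z" for z
    using gd reals_Archimedean2[of "norm z"] by blast
  then have "g holomorphic_on UNIV"
    by (simp add: holomorphic_on_def)
  moreover have sub: "ball 0 R \<subseteq> cball (0::complex) (real (nat \<lceil>R\<rceil>))" for R
    using real_nat_ceiling_ge[of R] by auto
  ultimately have "entire_limit (\<lambda>m. h (k m)) g"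
    unfolding entire_limit_def
    by (auto intro: uniform_limit_on_subset[OF ul sub] eventually_mono[OF evh] holomorphic_on_subset[OF _ sub])
  with k(1) show thesis by (rule that)
qed

section \<open>Entire functions of exponential type\<close>

definition exp_type :: "(complex \<Rightarrow> complex) \<Rightarrow> bool" where
  "exp_type F \<longleftrightarrow> (\<exists>A B. \<forall>z. norm (F z) \<le> A * exp (B * norm z))"

lemma exp_typeE:
  assumes "exp_type F"
  obtains A B where "A > 0" "B \<ge> 0" "\<And>z. norm (F z) \<le> A * exp (B * norm z)"
proof -
  obtain A B where AB: "\<And>z. norm (F z) \<le> A * exp (B * norm z)"
    using assms by (auto simp: exp_type_def)
  have "norm (F z) \<le> (\<bar>A\<bar> + 1) * exp (\<bar>B\<bar> * norm z)" for z
  proof -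
    have "A * exp (B * norm z) \<le> (\<bar>A\<bar> + 1) * exp (\<bar>B\<bar> * norm z)"
      by (intro mult_mono) (auto intro!: mult_right_mono)
    with AB[of z] show ?thesis by linarith
  qed
  then show thesis
    by (intro that[of "\<bar>A\<bar> + 1" "\<bar>B\<bar>"]) auto
qed

lemma exp_type_const: "exp_type (\<lambda>_. c)"
  unfolding exp_type_def by (intro exI[of _ "norm c"] exI[of _ 0]) auto

lemma exp_type_mult:
  assumes "exp_type F" "exp_type G"
  shows "exp_type (\<lambda>z. F z * G z)"
proof -
  obtain A B where F: "A > 0" "B \<ge> 0" "\<And>z. norm (F z) \<le> A * exp (B * norm z)"
    using exp_typeE[OF assms(1)] by metis
  obtain A' B' where G: "A' > 0" "B' \<ge> 0" "\<And>z. norm (G z) \<le> A' * exp (B' * norm z)"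
    using exp_typeE[OF assms(2)] by metis
  have "norm (F z * G z) \<le> (A * A') * exp ((B + B') * norm z)" for z
    using mult_mono[OF F(3)[of z] G(3)[of z]] F(1)
    by (simp add: norm_mult algebra_simps exp_add)
  then show ?thesis by (auto simp: exp_type_def)
qed

lemma exp_type_diff_const:
  assumes "exp_type F"
  shows "exp_type (\<lambda>z. F z - c)"
proof -
  obtain A B where F: "A > 0" "B \<ge> 0" "\<And>z. norm (F z) \<le> A * exp (B * norm z)"
    using exp_typeE[OF assms(1)] by metis
  have "norm (F z - c) \<le> (A + norm c) * exp (B * norm z)" for z
  proof -
    have "norm (F z - c) \<le> norm (F z) + norm c * 1"
      using norm_triangle_ineq4[of "F z" c] by simp
    also have "\<dots> \<le> A * exp (B * norm z) + norm c * exp (B * norm z)"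
      using F(2) F(3)[of z] by (intro add_mono mult_left_mono) auto
    finally show ?thesis by (simp add: distrib_right)
  qed
  then show ?thesis by (auto simp: exp_type_def)
qed

lemma exp_type_power: "exp_type F \<Longrightarrow> exp_type (\<lambda>z. F z ^ n)"
  by (induction n) (simp_all add: exp_type_const exp_type_mult)

lemma exp_type_prod: "(\<And>j. j \<in> J \<Longrightarrow> exp_type (F j)) \<Longrightarrow> exp_type (\<lambda>z. \<Prod>j\<in>J. F j z)"
  by (induction J rule: infinite_finite_induct) (simp_all add: exp_type_const exp_type_mult)

lemma exp_type_deriv:
  assumes "F holomorphic_on UNIV" "exp_type F"
  shows "exp_type (deriv F)"
proof -
  obtain A B where F: "A > 0" "B \<ge> 0" "\<And>z. norm (F z) \<le> A * exp (B * norm z)"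
    using exp_typeE[OF assms(2)] by metis
  have "norm (deriv F z) \<le> (2 * A * exp B) * exp (B * norm z)" for z
  proof -
    have "norm ((deriv ^^ 1) F z) \<le> fact 1 * (2 * A * exp B * exp (B * norm z)) / 1 ^ 1"
    proof (rule Cauchy_higher_deriv_bound[where y = 0])
      fix w assume "w \<in> ball z 1"
      then have "norm w \<le> norm z + 1"
        using norm_triangle_ineq2[of w z] by (simp add: dist_norm norm_minus_commute)
      then have "B * norm w \<le> B + B * norm z"
        using mult_left_mono[of "norm w" "norm z + 1" B] F(2) by (simp add: algebra_simps)
      then have "A * exp (B * norm w) \<le> A * exp (B + B * norm z)"
        using F(1) by simp
      moreover have "A * exp (B + B * norm z) > 0" using F(1) by simp
      ultimately have "norm (F w) < 2 * (A * exp (B + B * norm z))"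
        using F(3)[of w] by linarith
      then show "F w \<in> ball 0 (2 * A * exp B * exp (B * norm z))"
        by (simp add: exp_add mult_ac)
    next
      show "F holomorphic_on ball z 1" using assms(1) by (rule holomorphic_on_subset) auto
      show "continuous_on (cball z 1) F"
        using assms(1) by (meson continuous_on_subset holomorphic_on_imp_continuous_on subset_UNIV)
    qed auto
    then show ?thesis by simp
  qed
  then show ?thesis by (auto simp: exp_type_def)
qed

lemma exp_type_higher_deriv:
  assumes "F holomorphic_on UNIV" "exp_type F"
  shows "exp_type ((deriv ^^ t) F)"
proof (induction t)
  case (Suc t)
  have "(deriv ^^ t) F holomorphic_on UNIV"
    using assms(1) by (intro holomorphic_higher_deriv) auto
  then show ?case using exp_type_deriv Suc by simp
qed (simp add: assms)

lemma holomorphic_diff_monomial: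
  assumes "g holomorphic_on S" "open S"
  shows "diff_monomial n k ns ts g holomorphic_on S"
  unfolding diff_monomial_def using assms by (intro holomorphic_intros) auto

lemma exp_type_diff_monomial:
  assumes "g holomorphic_on UNIV" "exp_type g"
  shows "exp_type (diff_monomial n k ns ts g)"
  unfolding diff_monomial_def using assms
  by (intro exp_type_mult exp_type_power exp_type_prod exp_type_higher_deriv holomorphic_intros) auto

text \<open>
  Write \<open>F = exp h\<close>. Then \<open>Re h\<close> has an upper bound of linear growth, so \<open>m - h\<close> has positive real part
  on the disc of radius \<open>2 * \<bar>z\<bar>\<close> for some \<open>m\<close> of order \<open>\<bar>z\<bar>\<close>. By \<open>half_plane_norm_bound\<close> \<open>h\<close> itself
  grows at most linearly, and Liouville makes it affine.
\<close>

lemma nonvanishing_exp_type: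
  assumes F: "F holomorphic_on UNIV" and et: "exp_type F" and nz: "\<And>z. F z \<noteq> 0"
  obtains c d where "\<And>z. F z = exp (c * z + d)"
proof -
  obtain A B where AB: "A > 0" "B \<ge> 0" "\<And>z. norm (F z) \<le> A * exp (B * norm z)"
    using exp_typeE[OF et] by metis
  have "simply_connected (UNIV :: complex set)"
    by (simp add: convex_imp_simply_connected)
  then obtain h where h: "h holomorphic_on UNIV" and Fh: "\<And>z. F z = exp (h z)"
    using simply_connected_eq_holomorphic_log[of UNIV] F nz by (metis UNIV_I open_UNIV)
  have Re_h: "Re (h z) \<le> ln A + B * norm z" for z
  proof -
    have "exp (Re (h z)) \<le> exp (ln A + B * norm z)"
      using AB(3)[of z] AB(1) by (simp add: Fh exp_add norm_exp_eq_Re)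
    then show ?thesis by simp
  qed
  define K where "K = 4 * \<bar>ln A\<bar> + 8 * B + 4 + 3 * norm (h 0)"
  have bound: "norm (h z) \<le> K * norm z ^ 1" if z: "1 \<le> norm z" for z
  proof -
    \<comment> \<open>exceeds \<open>Re h\<close> on the disc of radius \<open>2 * \<bar>z\<bar>\<close>\<close>
    define m where "m = \<bar>ln A\<bar> + 2 * B * norm z + 1"
    have m: "m \<ge> 0" using AB by (simp add: m_def)
    have "norm (of_real m - h z) \<le> 3 * norm (of_real m - h 0)"
    proof (rule half_plane_norm_bound[of _ 0 "2 * norm z"])
      show "(\<lambda>w. of_real m - h w) holomorphic_on ball 0 (2 * norm z)"
        using h by (intro holomorphic_intros) (auto intro: holomorphic_on_subset)
      fix w :: complex assume "w \<in> ball 0 (2 * norm z)"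
      then have "B * norm w \<le> B * (2 * norm z)"
        using AB(2) by (intro mult_left_mono) auto
      then show "0 < Re (of_real m - h w)"
        using Re_h[of w] by (simp add: m_def)
    qed (use z in auto)
    moreover have "norm (of_real m - h 0) \<le> m + norm (h 0)"
      using norm_triangle_ineq4[of "of_real m" "h 0"] m by simp
    moreover have "norm (h z) \<le> m + norm (of_real m - h z)"
      using norm_triangle_ineq4[of "of_real m" "of_real m - h z"] m by simp
    ultimately have "norm (h z) \<le> 4 * m + 3 * norm (h 0)" by linarith
    also have "\<dots> = (4 * \<bar>ln A\<bar> + 4 + 3 * norm (h 0)) * 1 + 8 * B * norm z"
      by (simp add: m_def)
    also have "\<dots> \<le> (4 * \<bar>ln A\<bar> + 4 + 3 * norm (h 0)) * norm z + 8 * B * norm z"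
      using z by (intro add_right_mono mult_left_mono) auto
    also have "\<dots> = K * norm z ^ 1"
      by (simp add: K_def algebra_simps)
    finally show ?thesis .
  qed
  have hz: "h z = h 0 + deriv h 0 * z" for z
  proof -
    have "h z = (\<Sum>k\<le>1. (deriv ^^ k) h 0 / fact k * z ^ k)"
      using bound by (rule Liouville_polynomial[OF h])
    also have "\<dots> = h 0 + deriv h 0 * z" by simp
    finally show ?thesis .
  qed
  have "F z = exp (deriv h 0 * z + h 0)" for z
    unfolding Fh by (subst hz) (simp only: add.commute)
  then show thesis by (rule that)
qed

lemma factor_out_zero:
  assumes F: "F holomorphic_on UNIV" and nz: "F w \<noteq> 0"
  obtains l H where "H holomorphic_on UNIV" "H a \<noteq> 0" "\<And>z. F z = (z - a) ^ l * H z"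
proof (cases "F a = 0")
  case False
  then show thesis using that[of F 0] F by simp
next
  case True
  have "\<not> F constant_on UNIV"
    using True nz by (metis UNIV_I constant_on_def)
  then obtain g r l where g: "0 < r" "g holomorphic_on ball a r"
      "\<And>w. w \<in> ball a r \<Longrightarrow> F w = (w - a) ^ l * g w" "\<And>w. w \<in> ball a r \<Longrightarrow> g w \<noteq> 0"
    using holomorphic_factor_zero_nonconstant[OF F open_UNIV connected_UNIV UNIV_I True]
    by (metis (no_types, lifting))
  define H where "H z = (if z = a then g a else F z / (z - a) ^ l)" for z
  have Hg: "H z = g z" if "z \<in> ball a r" for z
    using g(3)[OF that] by (auto simp: H_def)
  have "H holomorphic_on ball a r"
    using g(2) by (rule holomorphic_transform) (simp add: Hg)
  moreover have "(\<lambda>z. F z / (z - a) ^ l) holomorphic_on - {a}"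
    using F by (intro holomorphic_intros) (auto intro: holomorphic_on_subset)
  then have "H holomorphic_on - {a}"
    by (rule holomorphic_transform) (simp add: H_def)
  ultimately have "H holomorphic_on (ball a r \<union> - {a})"
    by (intro holomorphic_on_Un) auto
  moreover have "ball a r \<union> - {a} = UNIV" using g(1) by auto
  ultimately have "H holomorphic_on UNIV" by simp
  moreover have "H a \<noteq> 0" using g(1) g(4)[of a] by (simp add: H_def)
  moreover have "F z = (z - a) ^ l * H z" for z
    using g(1) g(3)[of a] by (auto simp: H_def)
  ultimately show thesis by (rule that)
qed

text \<open>
  This is the case of Hadamard's factorization that is needed: dividing by the zero preserves
  exponential type.
\<close>

lemma single_zero_exp_type:
  assumes F: "F holomorphic_on UNIV" and et: "exp_type F" and nz: "F w \<noteq> 0"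
    and zeros: "\<And>z. F z = 0 \<Longrightarrow> z = b"
  obtains l c d where "\<And>z. F z = (z - b) ^ l * exp (c * z + d)"
proof -
  obtain l H where H: "H holomorphic_on UNIV" "H b \<noteq> 0" "\<And>z. F z = (z - b) ^ l * H z"
    using factor_out_zero[OF F nz] by metis
  obtain A B where AB: "A > 0" "B \<ge> 0" "\<And>z. norm (F z) \<le> A * exp (B * norm z)"
    using exp_typeE[OF et] by metis
  have "compact (H ` cball b 1)"
    using H(1) by (intro compact_continuous_image holomorphic_on_imp_continuous_on) (auto intro: holomorphic_on_subset)
  then obtain K where K: "K > 0" "\<And>z. z \<in> cball b 1 \<Longrightarrow> norm (H z) \<le> K"
    using compact_imp_bounded bounded_pos by (metis imageI)
  have "norm (H z) \<le> (A + K) * exp (B * norm z)" for z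
  proof (cases "norm (z - b) \<le> 1")
    case True
    then have "norm (H z) \<le> K * 1"
      using K(2)[of z] by (simp add: dist_norm norm_minus_commute)
    also have "\<dots> \<le> (A + K) * exp (B * norm z)"
      using AB K by (intro mult_mono) auto
    finally show ?thesis .
  next
    case False
    then have "1 * norm (H z) \<le> norm (z - b) ^ l * norm (H z)"
      by (intro mult_right_mono one_le_power) auto
    also have "\<dots> = norm (F z)"
      by (simp add: H(3) norm_mult norm_power)
    also have "\<dots> \<le> (A + K) * exp (B * norm z)"
      using AB(3)[of z] K(1) by (simp add: distrib_right add_increasing2)
    finally show ?thesis by simp
  qed
  then have "exp_type H" by (auto simp: exp_type_def)
  moreover have "H z \<noteq> 0" for z
    using zeros[of z] H(2) H(3)[of z] by auto
  ultimately obtain c d where "\<And>z. H z = exp (c * z + d)"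
    using nonvanishing_exp_type[OF H(1)] by metis
  then show thesis using that[of l c d] H(3) by simp
qed

section \<open>Differential monomials at a zero\<close>

text \<open>
  That is, \<open>\<phi>\<close> is entire with a zero of order exactly \<open>m\<close> at \<open>a\<close> (no zero if \<open>m = 0\<close>). The global
  factorization makes the closure properties below mere calculations.
\<close>

definition zero_form :: "complex \<Rightarrow> nat \<Rightarrow> (complex \<Rightarrow> complex) \<Rightarrow> bool" where
  "zero_form a m \<phi> \<longleftrightarrow> (\<exists>h. h holomorphic_on UNIV \<and> h a \<noteq> 0 \<and> (\<forall>z. \<phi> z = (z - a) ^ m * h z))"

lemma zero_form_one: "zero_form a 0 (\<lambda>_. 1)"
  unfolding zero_form_def by (intro exI[of _ "\<lambda>_. 1"]) auto

lemma zero_form_mult: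
  assumes "zero_form a m \<phi>" "zero_form a m' \<psi>"
  shows "zero_form a (m + m') (\<lambda>z. \<phi> z * \<psi> z)"
proof -
  obtain h h' where "h holomorphic_on UNIV" "h a \<noteq> 0" "\<And>z. \<phi> z = (z - a) ^ m * h z"
    "h' holomorphic_on UNIV" "h' a \<noteq> 0" "\<And>z. \<psi> z = (z - a) ^ m' * h' z"
    using assms unfolding zero_form_def by metis
  then show ?thesis
    unfolding zero_form_def
    by (intro exI[of _ "\<lambda>z. h z * h' z"]) (auto intro!: holomorphic_intros simp: power_add mult_ac)
qed

lemma zero_form_power: "zero_form a m \<phi> \<Longrightarrow> zero_form a (n * m) (\<lambda>z. \<phi> z ^ n)"
  using zero_form_mult[of a m \<phi>] by (induction n) (simp_all add: zero_form_one)

lemma zero_form_prod: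
  assumes "finite J" "\<And>j. j \<in> J \<Longrightarrow> zero_form a (m j) (\<phi> j)"
  shows "zero_form a (\<Sum>j\<in>J. m j) (\<lambda>z. \<Prod>j\<in>J. \<phi> j z)"
  using assms
proof (induction J rule: finite_induct)
  case (insert x J)
  then have "zero_form a (m x + (\<Sum>j\<in>J. m j)) (\<lambda>z. \<phi> x z * (\<Prod>j\<in>J. \<phi> j z))"
    by (intro zero_form_mult) auto
  with insert.hyps show ?case by simp
qed (simp add: zero_form_one)

lemma zero_form_deriv:
  assumes "zero_form a (Suc m) \<phi>"
  shows "zero_form a m (deriv \<phi>)"
proof -
  obtain h where h: "h holomorphic_on UNIV" "h a \<noteq> 0" "\<And>z. \<phi> z = (z - a) ^ Suc m * h z"
    using assms unfolding zero_form_def by metis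
  have "deriv \<phi> z = (z - a) ^ m * (of_nat (Suc m) * h z + (z - a) * deriv h z)" for z
  proof (rule DERIV_imp_deriv)
    have dh: "(h has_field_derivative deriv h z) (at z)"
      using h(1) by (intro holomorphic_derivI[of _ UNIV]) auto
    have "((\<lambda>z. (z - a) ^ Suc m) has_field_derivative (1 + of_nat m) * (1 * (z - a) ^ m)) (at z)"
      by (intro DERIV_power_Suc) (auto intro!: derivative_eq_intros)
    from DERIV_mult[OF this dh] have "((\<lambda>z. (z - a) ^ Suc m * h z) has_field_derivative
        (z - a) ^ m * (of_nat (Suc m) * h z + (z - a) * deriv h z)) (at z)"
      by (rule DERIV_cong) (simp add: algebra_simps)
    then show "(\<phi> has_field_derivative (z - a) ^ m * (of_nat (Suc m) * h z + (z - a) * deriv h z)) (at z)"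
      by (subst ext[of \<phi> "\<lambda>z. (z - a) ^ Suc m * h z"]) (simp_all only: h(3))
  qed
  moreover have "of_nat (Suc m) * h a + (a - a) * deriv h a \<noteq> 0"
    using h(2) by (simp del: of_nat_Suc)
  moreover have "(\<lambda>z. of_nat (Suc m) * h z + (z - a) * deriv h z) holomorphic_on UNIV"
    using h(1) by (intro holomorphic_intros) auto
  ultimately show ?thesis
    unfolding zero_form_def by (intro exI[of _ "\<lambda>z. of_nat (Suc m) * h z + (z - a) * deriv h z"]) auto
qed

lemma zero_form_higher_deriv:
  assumes "zero_form a m \<phi>" "t \<le> m"
  shows "zero_form a (m - t) ((deriv ^^ t) \<phi>)"
  using assms(2)
proof (induction t)
  case (Suc t)
  then have "zero_form a (Suc (m - Suc t)) ((deriv ^^ t) \<phi>)"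
    by (simp add: Suc_diff_Suc)
  then show ?case using zero_form_deriv by simp
qed (simp add: assms)

lemma zero_form_not_const:
  assumes "zero_form a m \<phi>" "m > 0"
  shows "\<not> \<phi> constant_on UNIV"
proof
  assume "\<phi> constant_on UNIV"
  then obtain c where c: "\<And>z. \<phi> z = c" by (auto simp: constant_on_def)
  obtain h where h: "h holomorphic_on UNIV" "h a \<noteq> 0" "\<And>z. \<phi> z = (z - a) ^ m * h z"
    using assms(1) unfolding zero_form_def by metis
  have "c = 0"
    using c[of a] h(3)[of a] assms(2) by (simp add: zero_power)
  then have "h z = 0" if "z \<noteq> a" for z
    using c[of z] h(3)[of z] that by simp
  then have "(h \<longlongrightarrow> 0) (at a)"
    by (intro tendsto_eventually) (auto simp: eventually_at_filter)
  moreover have "(h \<longlongrightarrow> h a) (at a)"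
    using h(1) by (metis UNIV_I continuous_on_eq_continuous_at holomorphic_on_imp_continuous_on isContD open_UNIV)
  ultimately show False
    using h(2) tendsto_unique by (metis at_neq_bot)
qed

lemma zero_form_diff_monomial:
  assumes "zero_form a s g" "s \<ge> 1" and ge: "\<And>j. j \<in> {1..k} \<Longrightarrow> ns j \<ge> ts j"
  shows "zero_form a (n * s + (\<Sum>j=1..k. ns j * s - ts j)) (diff_monomial n k ns ts g)"
  unfolding diff_monomial_def
proof (intro zero_form_mult zero_form_power zero_form_prod zero_form_higher_deriv assms(1))
  fix j assume "j \<in> {1..k}"
  then show "ts j \<le> ns j * s"
    using ge[of j] assms(2) by (metis mult.right_neutral mult_le_mono)
qed simp

text \<open>
  A simple zero is the worst case, and there the order is \<open>n + (\<Sum>j. ns j) - (\<Sum>j. ts j)\<close>.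
\<close>

lemma diff_monomial_zero_order_ge:
  fixes ns ts :: "nat \<Rightarrow> nat"
  assumes "s \<ge> 1" and ge: "\<And>j. j \<in> {1..k} \<Longrightarrow> ns j \<ge> ts j"
    and sum: "n + (\<Sum>j=1..k. ns j) \<ge> 2 + (\<Sum>j=1..k. ts j)"
  shows "n * s + (\<Sum>j=1..k. ns j * s - ts j) \<ge> 2"
proof -
  have "(\<Sum>j=1..k. ns j) \<le> (\<Sum>j=1..k. (ns j * s - ts j) + ts j)"
  proof (rule sum_mono)
    fix j assume "j \<in> {1..k}"
    have "ns j \<le> ns j * s" using assms(1) by (cases s) auto
    then show "ns j \<le> (ns j * s - ts j) + ts j" by linarith
  qed
  moreover have "n \<le> n * s" using assms(1) by (cases s) auto
  ultimately show ?thesis using sum unfolding sum.distrib by linarith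
qed

section \<open>Products of polynomials and exponentials\<close>

definition poly_exp :: "complex \<Rightarrow> (complex \<Rightarrow> complex) \<Rightarrow> bool" where
  "poly_exp \<gamma> \<phi> \<longleftrightarrow> (\<exists>q. q \<noteq> 0 \<and> (\<forall>z. \<phi> z = poly q z * exp (\<gamma> * z)))"

lemma poly_exp_one: "poly_exp 0 (\<lambda>_. 1)"
  unfolding poly_exp_def by (intro exI[of _ 1]) auto

lemma poly_exp_mult:
  assumes "poly_exp \<gamma> \<phi>" "poly_exp \<gamma>' \<psi>"
  shows "poly_exp (\<gamma> + \<gamma>') (\<lambda>z. \<phi> z * \<psi> z)"
proof -
  obtain q q' where "q \<noteq> 0" "\<And>z. \<phi> z = poly q z * exp (\<gamma> * z)" "q' \<noteq> 0" "\<And>z. \<psi> z = poly q' z * exp (\<gamma>' * z)"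
    using assms unfolding poly_exp_def by metis
  then show ?thesis
    unfolding poly_exp_def by (intro exI[of _ "q * q'"]) (auto simp: exp_add distrib_left distrib_right mult_ac)
qed

lemma poly_exp_power: "poly_exp \<gamma> \<phi> \<Longrightarrow> poly_exp (of_nat n * \<gamma>) (\<lambda>z. \<phi> z ^ n)"
  using poly_exp_mult[of \<gamma> \<phi>] by (induction n) (simp_all add: poly_exp_one distrib_right)

lemma poly_exp_prod:
  assumes "finite J" "\<And>j. j \<in> J \<Longrightarrow> poly_exp (\<gamma> j) (\<phi> j)"
  shows "poly_exp (\<Sum>j\<in>J. \<gamma> j) (\<lambda>z. \<Prod>j\<in>J. \<phi> j z)"
  using assms
proof (induction J rule: finite_induct)
  case (insert x J)
  then have "poly_exp (\<gamma> x + (\<Sum>j\<in>J. \<gamma> j)) (\<lambda>z. \<phi> x z * (\<Prod>j\<in>J. \<phi> j z))"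
    by (intro poly_exp_mult) auto
  with insert.hyps show ?case by simp
qed (simp add: poly_exp_one)

lemma poly_exp_deriv:
  assumes "poly_exp \<gamma> \<phi>" "\<gamma> \<noteq> 0"
  shows "poly_exp \<gamma> (deriv \<phi>)"
proof -
  obtain q where q: "q \<noteq> 0" "\<And>z. \<phi> z = poly q z * exp (\<gamma> * z)"
    using assms unfolding poly_exp_def by metis
  have "deriv \<phi> z = poly (pderiv q + smult \<gamma> q) z * exp (\<gamma> * z)" for z
  proof (rule DERIV_imp_deriv)
    have "((\<lambda>z. poly q z * exp (\<gamma> * z)) has_field_derivative poly (pderiv q + smult \<gamma> q) z * exp (\<gamma> * z)) (at z)"
      by (auto intro!: derivative_eq_intros poly_DERIV[THEN DERIV_chain2] simp: algebra_simps)
    then show "(\<phi> has_field_derivative poly (pderiv q + smult \<gamma> q) z * exp (\<gamma> * z)) (at z)"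
      by (subst ext[of \<phi> "\<lambda>z. poly q z * exp (\<gamma> * z)"]) (simp_all only: q(2))
  qed
  moreover have "coeff (pderiv q + smult \<gamma> q) (degree q) = \<gamma> * lead_coeff q"
    by (simp add: coeff_pderiv coeff_eq_0)
  then have "pderiv q + smult \<gamma> q \<noteq> 0"
    using q(1) assms(2) by (metis coeff_0 leading_coeff_0_iff mult_eq_0_iff)
  ultimately show ?thesis unfolding poly_exp_def by blast
qed

lemma poly_exp_higher_deriv: "poly_exp \<gamma> \<phi> \<Longrightarrow> \<gamma> \<noteq> 0 \<Longrightarrow> poly_exp \<gamma> ((deriv ^^ t) \<phi>)"
  by (induction t) (simp_all add: poly_exp_deriv)

lemma poly_exp_diff_monomial:
  assumes "poly_exp \<gamma> g" "\<gamma> \<noteq> 0" "\<And>j. j \<in> {1..k} \<Longrightarrow> ns j > 0"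
  shows "poly_exp (of_nat (n + (\<Sum>j=1..k. ns j)) * \<gamma>) (diff_monomial n k ns ts g)"
proof -
  have "poly_exp (of_nat n * \<gamma> + (\<Sum>j=1..k. of_nat (ns j) * \<gamma>)) (diff_monomial n k ns ts g)"
    unfolding diff_monomial_def
    by (intro poly_exp_mult poly_exp_power poly_exp_prod poly_exp_higher_deriv assms(1))
       (use assms in auto)
  then show ?thesis by (simp add: distrib_right sum_distrib_right)
qed

text \<open>
  Differentiation lowers the degree of a nonzero polynomial but keeps the class of nonzero
  polynomial multiples of \<open>exp (\<gamma> * z)\<close>, so iterating it on a function of both kinds would make it vanish.
\<close>

lemma poly_exp_not_poly:
  assumes "poly_exp \<gamma> \<phi>" "\<gamma> \<noteq> 0"
  shows "\<exists>z. \<phi> z \<noteq> poly s z"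
proof (rule ccontr)
  assume "\<not> ?thesis"
  then have "\<phi> = poly s" by auto
  with assms(1) have "poly_exp \<gamma> (poly s)" by simp
  then show False
  proof (induction "degree s" arbitrary: s rule: less_induct)
    case less
    have d: "deriv (poly s) = poly (pderiv s)"
      by (auto intro!: DERIV_imp_deriv poly_DERIV)
    have pe: "poly_exp \<gamma> (poly (pderiv s))"
      using poly_exp_deriv[OF less.prems assms(2)] by (simp add: d)
    show ?case
    proof (cases "degree s = 0")
      case True
      then have "pderiv s = 0" by (simp add: pderiv_eq_0_iff)
      with pe obtain q where "q \<noteq> 0" "\<And>z. 0 = poly q z * exp (\<gamma> * z)"
        unfolding poly_exp_def by auto
      then have "poly q = poly 0" by (auto simp: fun_eq_iff)
      with \<open>q \<noteq> 0\<close> show False by (simp add: poly_eq_poly_eq_iff)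
    next
      case False
      then show False
        using less.hyps[OF _ pe] by (simp add: degree_pderiv)
    qed
  qed
qed

text \<open>
  If \<open>p\<close> were taken at most at \<open>b\<close>, then \<open>q * exp (\<gamma> * z) = p + r * exp (c * z)\<close> with polynomials \<open>q\<close>
  and \<open>r\<close>. For \<open>c = \<gamma>\<close> this makes a nonzero multiple of \<open>exp (- \<gamma> * z)\<close> a polynomial. Otherwise differentiate
  once to remove \<open>p\<close> and divide by \<open>exp (c * z)\<close>; then a nonzero polynomial multiple of
  \<open>exp ((\<gamma> - c) * z)\<close> is a polynomial.
\<close>

lemma poly_exp_not_single_value:
  assumes \<phi>: "poly_exp \<gamma> \<phi>" "\<gamma> \<noteq> 0" and p: "p \<noteq> 0"
    and hol: "\<phi> holomorphic_on UNIV" and et: "exp_type \<phi>"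
  shows "\<exists>z. \<phi> z = p \<and> z \<noteq> b"
proof (rule ccontr)
  assume "\<not> ?thesis"
  then have zeros: "\<And>z. \<phi> z - p = 0 \<Longrightarrow> z = b" by auto
  obtain w where "\<phi> w \<noteq> poly [:p:] w"
    using poly_exp_not_poly[OF \<phi>] by blast
  then have "\<phi> w - p \<noteq> 0" by simp
  moreover have "(\<lambda>z. \<phi> z - p) holomorphic_on UNIV"
    using hol by (intro holomorphic_intros)
  ultimately obtain l c d where F: "\<And>z. \<phi> z - p = (z - b) ^ l * exp (c * z + d)"
    using single_zero_exp_type[OF _ exp_type_diff_const[OF et] _ zeros] by metis
  define r where "r = smult (exp d) ([:- b, 1:] ^ l)"
  have \<phi>r: "\<phi> z - p = poly r z * exp (c * z)" for z
    by (simp add: F r_def exp_add poly_power)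
  obtain q where q: "q \<noteq> 0" "\<And>z. \<phi> z = poly q z * exp (\<gamma> * z)"
    using \<phi>(1) unfolding poly_exp_def by metis
  show False
  proof (cases "c = \<gamma>")
    case True
    have "poly_exp (- \<gamma>) (\<lambda>z. p * exp (- \<gamma> * z))"
      unfolding poly_exp_def using p by (intro exI[of _ "[:p:]"]) auto
    moreover have "p * exp (- \<gamma> * z) = poly (q - r) z" for z
    proof -
      have "p = (poly q z - poly r z) * exp (\<gamma> * z)"
        using \<phi>r[of z] q(2)[of z] True by (simp add: algebra_simps)
      then have "p * exp (- \<gamma> * z) = (poly q z - poly r z) * (exp (\<gamma> * z) * exp (- \<gamma> * z))"
        by simp
      also have "exp (\<gamma> * z) * exp (- \<gamma> * z) = 1"
        by (simp flip: exp_add)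
      finally show ?thesis by simp
    qed
    ultimately show False
      using poly_exp_not_poly[of "- \<gamma>" _ "q - r"] \<phi>(2) by auto
  next
    case False
    obtain q1 where q1: "q1 \<noteq> 0" "\<And>z. deriv \<phi> z = poly q1 z * exp (\<gamma> * z)"
      using poly_exp_deriv[OF \<phi>] unfolding poly_exp_def by metis
    have d2: "deriv \<phi> z = poly (pderiv r + smult c r) z * exp (c * z)" for z
    proof (rule DERIV_imp_deriv)
      have "((\<lambda>z. p + poly r z * exp (c * z)) has_field_derivative poly (pderiv r + smult c r) z * exp (c * z)) (at z)"
        by (auto intro!: derivative_eq_intros poly_DERIV[THEN DERIV_chain2] simp: algebra_simps)
      moreover have "\<phi> = (\<lambda>z. p + poly r z * exp (c * z))"
        using \<phi>r by (auto simp: fun_eq_iff algebra_simps)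
      ultimately show "(\<phi> has_field_derivative poly (pderiv r + smult c r) z * exp (c * z)) (at z)"
        by simp
    qed
    have "poly_exp (\<gamma> - c) (\<lambda>z. poly q1 z * exp ((\<gamma> - c) * z))"
      unfolding poly_exp_def using q1(1) by blast
    moreover have "poly q1 z * exp ((\<gamma> - c) * z) = poly (pderiv r + smult c r) z" for z
    proof -
      have "poly q1 z * exp (\<gamma> * z) = poly (pderiv r + smult c r) z * exp (c * z)"
        using q1(2)[of z] d2[of z] by simp
      then have "poly q1 z * (exp (\<gamma> * z) * exp (- c * z)) = poly (pderiv r + smult c r) z * (exp (c * z) * exp (- c * z))"
        by (simp only: mult.assoc[symmetric])
      moreover have "exp (\<gamma> * z) * exp (- c * z) = exp ((\<gamma> - c) * z)" "exp (c * z) * exp (- c * z) = 1"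
        by (simp_all add: algebra_simps flip: exp_add)
      ultimately show ?thesis by (simp only: mult_1_right)
    qed
    ultimately show False
      using poly_exp_not_poly[of "\<gamma> - c" _ "pderiv r + smult c r"] False by auto
  qed
qed

section \<open>Differential monomials of entire functions of exponential type\<close>

text \<open>
  This settles the functions \<open>g\<close> with a single zero and no exponential factor, to which
  \<open>poly_exp_not_single_value\<close> does not apply: a nonzero value is taken at the translated roots of
  order equal to the exponent.
\<close>

lemma pure_power_diff_monomial:
  assumes g: "\<And>z. g z = C * (z - a) ^ s" and C: "C \<noteq> 0" and s: "s \<ge> 1"
    and ge: "\<And>j. j \<in> {1..k} \<Longrightarrow> ns j \<ge> ts j"
  shows "\<exists>K. K \<noteq> 0 \<and>
    (\<forall>z. diff_monomial n k ns ts g z = K * (z - a) ^ (n * s + (\<Sum>j=1..k. ns j * s - ts j)))"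
proof -
  define \<kappa> where "\<kappa> j = C ^ ns j * pochhammer (of_nat (Suc (ns j * s) - ts j)) (ts j)" for j
  have \<kappa>: "\<kappa> j \<noteq> 0" if "j \<in> {1..k}" for j
  proof -
    have "ns j \<le> ns j * s" using s by (cases s) auto
    then have "ts j \<le> ns j * s" using ge[OF that] by linarith
    then have "of_nat (Suc (ns j * s) - ts j) \<noteq> (0 :: complex)"
      by (metis Suc_diff_le nat.distinct(1) of_nat_eq_0_iff)
    then have "pochhammer (of_nat (Suc (ns j * s) - ts j)) (ts j) \<noteq> (0 :: complex)"
      using pochhammer_of_nat[of "Suc (ns j * s) - ts j" "ts j"] pochhammer_pos[of "Suc (ns j * s) - ts j" "ts j"]
      by (metis gr0I less_numeral_extra(3) of_nat_0 of_nat_eq_iff)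
    then show ?thesis using C by (simp add: \<kappa>_def)
  qed
  have hd: "(deriv ^^ ts j) (\<lambda>w. g w ^ ns j) z = \<kappa> j * (z - a) ^ (ns j * s - ts j)" for j z
  proof -
    have "(\<lambda>w. g w ^ ns j) = (\<lambda>w. C ^ ns j * (w - a) ^ (ns j * s))"
      by (simp add: g power_mult_distrib mult.commute flip: power_mult)
    then have "(deriv ^^ ts j) (\<lambda>w. g w ^ ns j) z = (deriv ^^ ts j) (\<lambda>w. C ^ ns j * (w - a) ^ (ns j * s)) z"
      by (simp only:)
    also have "\<dots> = C ^ ns j * (deriv ^^ ts j) (\<lambda>w. (w - a) ^ (ns j * s)) z"
      by (rule higher_deriv_cmult[of _ UNIV]) (auto intro!: holomorphic_intros)
    finally show ?thesis
      by (simp only: higher_deriv_power \<kappa>_def mult.assoc)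
  qed
  show ?thesis
  proof (intro exI conjI allI)
    show "C ^ n * (\<Prod>j=1..k. \<kappa> j) \<noteq> 0" using C \<kappa> by simp
    fix z
    have "(\<Prod>j=1..k. (z - a) ^ (ns j * s - ts j)) = (z - a) ^ (\<Sum>j=1..k. ns j * s - ts j)"
      by (simp add: power_sum)
    then show "diff_monomial n k ns ts g z
        = C ^ n * (\<Prod>j=1..k. \<kappa> j) * (z - a) ^ (n * s + (\<Sum>j=1..k. ns j * s - ts j))"
      unfolding diff_monomial_def hd prod.distrib
      by (simp add: g power_mult_distrib power_add mult_ac flip: power_mult)
  qed
qed

text \<open>
  Applied to two choices of \<open>b\<close>, the second claim yields two distinct points where the value \<open>p\<close> is
  taken; stating it with an arbitrary exceptional point \<open>b\<close> is what the proof by contradiction uses.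
\<close>

lemma diff_monomial_two_values:
  fixes g :: "complex \<Rightarrow> complex" and ns ts :: "nat \<Rightarrow> nat"
  assumes g: "g holomorphic_on UNIV" "exp_type g" "\<not> g constant_on UNIV"
    and p: "p \<noteq> 0" and pos: "\<And>j. j \<in> {1..k} \<Longrightarrow> ns j > 0"
    and ge: "\<And>j. j \<in> {1..k} \<Longrightarrow> ns j \<ge> ts j"
    and sum: "n + (\<Sum>j=1..k. ns j) \<ge> 2 + (\<Sum>j=1..k. ts j)"
  shows "\<not> diff_monomial n k ns ts g constant_on UNIV"
    and "\<exists>z. diff_monomial n k ns ts g z = p \<and> z \<noteq> b"
proof -
  define P where "P = diff_monomial n k ns ts g"
  have P: "P holomorphic_on UNIV" "exp_type P"
    using g by (auto simp: P_def intro: holomorphic_diff_monomial exp_type_diff_monomial)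
  define N where "N = n + (\<Sum>j=1..k. ns j)"
  have N: "N > 0" using sum unfolding N_def by linarith
  obtain w where w: "g w \<noteq> 0"
    using g(3) by (auto simp: constant_on_def)
  have P_exp: "poly_exp (of_nat N * c) P" "of_nat N * c \<noteq> 0"
    if "\<And>z. g z = (z - a) ^ s * exp (c * z + d)" "c \<noteq> 0" for a s c d
  proof -
    have "poly_exp c g"
      unfolding poly_exp_def that(1)
      by (intro exI[of _ "smult (exp d) ([:- a, 1:] ^ s)"]) (auto simp: exp_add poly_power)
    then show "poly_exp (of_nat N * c) P"
      using poly_exp_diff_monomial[OF _ that(2) pos] by (simp add: P_def N_def)
    show "of_nat N * c \<noteq> 0" using N that(2) by simp
  qed
  have zero: "\<exists>m. zero_form a (Suc (Suc m)) P" if "g a = 0" for a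
  proof -
    obtain s H where H: "H holomorphic_on UNIV" "H a \<noteq> 0" "\<And>z. g z = (z - a) ^ s * H z"
      using factor_out_zero[OF g(1) w] by metis
    have s: "s \<ge> 1" using H(2) H(3)[of a] that by (cases s) auto
    have zf: "zero_form a s g" unfolding zero_form_def using H by blast
    obtain m where "n * s + (\<Sum>j=1..k. ns j * s - ts j) = 2 + m"
      using diff_monomial_zero_order_ge[OF s ge sum] le_Suc_ex by blast
    moreover have "zero_form a (n * s + (\<Sum>j=1..k. ns j * s - ts j)) P"
      unfolding P_def by (rule zero_form_diff_monomial[OF zf s]) (rule ge)
    ultimately have "zero_form a (Suc (Suc m)) P" by simp
    then show ?thesis by blast
  qed
  have nonconst: "\<not> P constant_on UNIV"
  proof (cases "\<exists>a. g a = 0")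
    case True
    then show ?thesis using zero zero_form_not_const by blast
  next
    case False
    then obtain c d where cd: "\<And>z. g z = exp (c * z + d)"
      using nonvanishing_exp_type[OF g(1,2)] by metis
    then have "c \<noteq> 0" using g(3) by (auto simp: constant_on_def)
    have "g z = (z - 0) ^ 0 * exp (c * z + d)" for z
      using cd by simp
    note pe = P_exp[OF this \<open>c \<noteq> 0\<close>]
    show ?thesis
    proof
      assume "P constant_on UNIV"
      then obtain \<kappa> where "\<And>z. P z = \<kappa>" by (auto simp: constant_on_def)
      then show False using poly_exp_not_poly[OF pe, of "[:\<kappa>:]"] by simp
    qed
  qed
  then show "\<not> diff_monomial n k ns ts g constant_on UNIV" by (simp add: P_def)
  have "\<exists>z. P z = p \<and> z \<noteq> b"
  proof (rule ccontr)
    assume "\<not> ?thesis"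
    then have single: "\<And>z. P z = p \<Longrightarrow> z = b" by auto
    obtain w' where "P w' - p \<noteq> 0"
      using nonconst by (auto simp: constant_on_def)
    moreover have "(\<lambda>z. P z - p) holomorphic_on UNIV"
      using P by (intro holomorphic_intros)
    ultimately obtain l c d where F: "\<And>z. P z - p = (z - b) ^ l * exp (c * z + d)"
      using single_zero_exp_type[of "\<lambda>z. P z - p" w' b] exp_type_diff_const[OF P(2)] single by auto
    \<comment> \<open>both \<open>P g\<close> and its derivative vanish at \<open>a\<close>, while \<open>P g - p\<close> has logarithmic derivative
      \<open>l / (z - b) + c\<close>\<close>
    have key: "of_nat l + c * (a - b) = 0" if a: "g a = 0" for a
    proof -
      obtain m where zf: "zero_form a (Suc (Suc m)) P" using zero[OF a] by blast
      then have Pa: "P a = 0" by (auto simp: zero_form_def)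
      have dPa: "deriv P a = 0"
        using zero_form_deriv[OF zf] by (auto simp: zero_form_def)
      have 1: "((\<lambda>z. p + (z - b) ^ l * exp (c * z + d)) has_field_derivative
          (of_nat l * (a - b) ^ (l - 1) + c * (a - b) ^ l) * exp (c * a + d)) (at a)"
        by (auto intro!: derivative_eq_intros simp: algebra_simps)
      have 2: "P = (\<lambda>z. p + (z - b) ^ l * exp (c * z + d))"
        using F by (auto simp: fun_eq_iff algebra_simps)
      from 1 have "(P has_field_derivative (of_nat l * (a - b) ^ (l - 1) + c * (a - b) ^ l) * exp (c * a + d)) (at a)"
        by (simp only: 2)
      then have "(of_nat l * (a - b) ^ (l - 1) + c * (a - b) ^ l) * exp (c * a + d) = 0"
        using dPa DERIV_imp_deriv by metis
      then have "of_nat l * (a - b) ^ (l - 1) + c * (a - b) ^ l = 0"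
        by simp
      moreover have "(of_nat l * (a - b) ^ (l - 1) + c * (a - b) ^ l) * (a - b)
          = (of_nat l + c * (a - b)) * (a - b) ^ l"
        by (cases l) (simp_all add: algebra_simps)
      ultimately have "(of_nat l + c * (a - b)) * (a - b) ^ l = 0" by simp
      moreover have "(a - b) ^ l \<noteq> 0"
        using F[of a] Pa p by (cases "(a - b) ^ l = 0") auto
      ultimately show ?thesis by (simp only: mult_eq_0_iff simp_thms)
    qed
    \<comment> \<open>if \<open>c = 0\<close> then \<open>g\<close> has no zeros, and any value of \<open>a\<close> will do\<close>
    define a where "a = b - of_nat l / c"
    have ga: "z = a" if "g z = 0" for z
    proof (cases "c = 0")
      case True
      then have "l = 0" using key[OF that] by simp
      then have "P constant_on UNIV"
        using F True unfolding constant_on_def by (metis add.commute diff_add_cancel mult_zero_left power_0)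
      with nonconst show ?thesis by simp
    next
      case False
      then show ?thesis using key[OF that] by (simp add: a_def field_simps)
    qed
    obtain s c' d' where g_eq: "\<And>z. g z = (z - a) ^ s * exp (c' * z + d')"
      using single_zero_exp_type[OF g(1,2) w ga] by metis
    show False
    proof (cases "c' = 0")
      case False
      then show False
        using poly_exp_not_single_value[OF P_exp[OF g_eq False] p P, of b] single by blast
    next
      case True
      then have g_eq': "g z = exp d' * (z - a) ^ s" for z by (simp add: g_eq)
      have s: "s \<ge> 1"
        using g(3) g_eq' by (cases s) (auto simp: constant_on_def)
      define e where "e = n * s + (\<Sum>j=1..k. ns j * s - ts j)"
      have e: "e \<ge> 2"
        unfolding e_def using diff_monomial_zero_order_ge[OF s ge sum] by simp
      obtain K where K: "K \<noteq> 0" "\<And>z. P z = K * (z - a) ^ e"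
      proof -
        have "\<exists>K. K \<noteq> 0 \<and> (\<forall>z. P z = K * (z - a) ^ e)"
          unfolding P_def e_def
          by (rule pure_power_diff_monomial[OF g_eq' exp_not_eq_zero s]) (rule ge)
        then show thesis using that by blast
      qed
      \<comment> \<open>but a nonzero number has \<open>e \<ge> 2\<close> roots of order \<open>e\<close>\<close>
      have "{z. z ^ e = p / K} \<subseteq> {b - a}"
      proof
        fix z assume "z \<in> {z. z ^ e = p / K}"
        then have "P (z + a) = p" using K by simp
        then show "z \<in> {b - a}" using single by force
      qed
      then have "card {z. z ^ e = p / K} \<le> card {b - a}"
        by (rule card_mono[rotated]) simp
      moreover have "card {z. z ^ e = p / K} = e"
        using p K e by (intro card_nth_roots) auto
      ultimately show False using e by simp
    qed
  qed
  then show "\<exists>z. diff_monomial n k ns ts g z = p \<and> z \<noteq> b" by (simp add: P_def)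
qed

section \<open>Rescaling at a point of unbounded spherical derivative\<close>

text \<open>
  Read \<open>Q z s\<close> as: rescaling \<open>f\<close> at \<open>z\<close> with scale \<open>s\<close> and weight \<open>s powr \<alpha>\<close> gives a function
  whose spherical derivative at \<open>0\<close> is at least \<open>1\<close>. With \<open>dd z\<close> the distance to the circle of
  radius \<open>r\<close>, choose among all pairs with \<open>Q z s\<close> and \<open>s \<le> dd z\<close> one that minimizes \<open>s / dd z\<close>. The
  minimum \<open>t\<close> is small because the spherical derivative at \<open>c\<close> is large. In the rescaled disc of radius
  \<open>1 / (2 * t)\<close> the function \<open>dd\<close> exceeds half its value at the minimizer, so by minimality \<open>Q\<close> fails
  there at the scale \<open>\<rho> / 2\<close>. This is the upper bound, with the factor \<open>4\<close> paying for the change of scale from \<open>\<rho> / 2\<close>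
  to \<open>\<rho>\<close>. The assumption \<open>\<alpha> < 1\<close> keeps the scales of admissible pairs away from \<open>0\<close>, which gives
  compactness.
\<close>

lemma zalcman_pang_point:
  fixes f :: "complex \<Rightarrow> complex" and \<alpha> r \<epsilon> :: real
  assumes \<alpha>: "0 \<le> \<alpha>" "\<alpha> < 1" and r: "0 < r" "r \<le> 1" and \<epsilon>: "0 < \<epsilon>" "\<epsilon> \<le> 1"
    and D: "open D" "cball a r \<subseteq> D" and f: "f holomorphic_on D"
    and c: "norm (c - a) \<le> r / 2"
    and big: "norm (deriv f c) \<ge> (2 / (\<epsilon> * r))\<^sup>2 * (1 + (norm (f c))\<^sup>2)"
  obtains b \<rho> t where "0 < t" "t \<le> \<epsilon>" "b \<in> ball a r" "0 < \<rho>" "\<rho> \<le> t"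
    "(\<rho> powr \<alpha>)\<^sup>2 + (norm (f b))\<^sup>2 \<le> \<rho> * \<rho> powr \<alpha> * norm (deriv f b)"
    "\<And>w. norm w < 1 / (2 * t) \<Longrightarrow> b + of_real \<rho> * w \<in> ball a r \<and>
       \<rho> * \<rho> powr \<alpha> * norm (deriv f (b + of_real \<rho> * w)) \<le> 4 * ((\<rho> powr \<alpha>)\<^sup>2 + (norm (f (b + of_real \<rho> * w)))\<^sup>2)"
proof -
  define Q where "Q z s \<longleftrightarrow> (s powr \<alpha>)\<^sup>2 + (norm (f z))\<^sup>2 \<le> s * s powr \<alpha> * norm (deriv f z)" for z s
  have contf: "continuous_on (cball a r) f" "continuous_on (cball a r) (deriv f)"
    using f D by (auto intro!: holomorphic_on_imp_continuous_on holomorphic_on_subset[OF _ D(2)] holomorphic_deriv)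
  have "bounded (deriv f ` cball a r)"
    using contf by (intro compact_imp_bounded compact_continuous_image) auto
  then obtain K where K: "K \<ge> 0" "\<And>z. z \<in> cball a r \<Longrightarrow> norm (deriv f z) \<le> K"
    by (metis bounded_pos imageI less_imp_le)
  \<comment> \<open>below this scale \<open>s powr (1 - \<alpha>) * \<bar>f'\<bar> < 1\<close>, which contradicts \<open>Q\<close>\<close>
  define s0 where "s0 = (1 / (K + 1)) powr (1 / (1 - \<alpha>))"
  have s0: "s0 > 0"
    using K by (simp add: s0_def)
  have Q_lower: "s0 \<le> s" if "z \<in> cball a r" "0 < s" "Q z s" for z s
  proof (rule ccontr)
    assume "\<not> s0 \<le> s"
    then have "s powr (1 - \<alpha>) < s0 powr (1 - \<alpha>)"
      using that \<alpha> by (intro powr_less_mono2) auto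
    also have "\<dots> = 1 / (K + 1)"
      using \<alpha> K by (simp add: s0_def powr_powr)
    finally have 1: "s powr (1 - \<alpha>) * (K + 1) < 1"
      using K by (simp add: field_simps)
    have "s powr \<alpha> * s powr \<alpha> \<le> s powr \<alpha> * (s * norm (deriv f z))"
      using order_trans[OF _ that(3)[unfolded Q_def], of "(s powr \<alpha>)\<^sup>2"]
      by (simp add: power2_eq_square mult_ac)
    then have "s powr \<alpha> \<le> s * norm (deriv f z)"
      using that(2) by simp
    also have "\<dots> \<le> s * K"
      using K(2)[OF that(1)] that(2) by (intro mult_left_mono) auto
    also have "s * K = s powr \<alpha> * s powr (1 - \<alpha>) * K"
      using that(2) by (simp flip: powr_add)
    finally have "s powr \<alpha> * 1 \<le> s powr \<alpha> * (s powr (1 - \<alpha>) * K)"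
      by (simp add: mult_ac)
    then have "1 \<le> s powr (1 - \<alpha>) * K"
      using that(2) by (subst (asm) mult_le_cancel_left_pos) auto
    moreover have "s powr (1 - \<alpha>) * K \<le> s powr (1 - \<alpha>) * (K + 1)"
      by (intro mult_left_mono) auto
    ultimately show False using 1 by linarith
  qed
  define dd where "dd z = r - norm (z - a)" for z
  define \<CC> where "\<CC> = {p \<in> cball a r \<times> {s0..1}. snd p \<le> dd (fst p) \<and> Q (fst p) (snd p)}"
  have "compact \<CC>"
  proof -
    let ?K = "cball a r \<times> {s0..1}"
    define \<psi> where "\<psi> p = snd p * snd p powr \<alpha> * norm (deriv f (fst p)) - ((snd p powr \<alpha>)\<^sup>2 + (norm (f (fst p)))\<^sup>2)" for p
    have cK: "continuous_on ?K (\<lambda>p. f (fst p))" "continuous_on ?K (\<lambda>p. deriv f (fst p))"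
      by (auto intro!: continuous_on_compose2[OF contf(1)] continuous_on_compose2[OF contf(2)] continuous_intros)
    have "continuous_on ?K \<psi>"
      unfolding \<psi>_def using s0 by (intro continuous_intros cK) auto
    then have 1: "closed (?K \<inter> \<psi> -` {0..})"
      by (intro continuous_closed_preimage) (auto intro!: closed_Times)
    have "continuous_on ?K (\<lambda>p. dd (fst p) - snd p)"
      unfolding dd_def by (intro continuous_intros)
    then have 2: "closed (?K \<inter> (\<lambda>p. dd (fst p) - snd p) -` {0..})"
      by (intro continuous_closed_preimage) (auto intro!: closed_Times)
    have "\<CC> = ?K \<inter> ((?K \<inter> \<psi> -` {0..}) \<inter> (?K \<inter> (\<lambda>p. dd (fst p) - snd p) -` {0..}))"
      by (auto simp: \<CC>_def Q_def \<psi>_def)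
    moreover have "compact ?K"
      by (intro compact_Times) auto
    ultimately show ?thesis
      using 1 2 by (simp only: compact_Int_closed closed_Int)
  qed
  \<comment> \<open>the point \<open>c\<close> supplies an admissible pair with quotient \<open>\<epsilon>\<close>\<close>
  define s1 where "s1 = \<epsilon> * dd c"
  have dc: "r / 2 \<le> dd c" "dd c \<le> r"
    using c by (auto simp: dd_def)
  have ccb: "c \<in> cball a r"
    using c r by (simp add: dist_norm norm_minus_commute)
  have s1: "0 < s1" "\<epsilon> * r / 2 \<le> s1" "s1 \<le> dd c"
    using dc \<epsilon> r mult_left_mono[OF dc(1), of \<epsilon>] mult_right_mono[of \<epsilon> 1 "dd c"] by (auto simp: s1_def)
  have "Q c s1"
  proof -
    have s1_1: "s1 \<le> 1"
      using s1 dc r by linarith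
    have "s1 powr \<alpha> \<le> s1 powr 0" 
      using s1 s1_1 \<alpha> by (intro powr_mono') auto
    then have p1: "s1 powr \<alpha> \<le> 1"
      using s1 by simp
    have p2: "s1 powr \<alpha> \<ge> s1"
      using powr_mono'[of \<alpha> 1 s1] s1 s1_1 \<alpha> by simp
    have "(s1 powr \<alpha>)\<^sup>2 + (norm (f c))\<^sup>2 \<le> 1 * (1 + (norm (f c))\<^sup>2)"
      using p1 by (simp add: power_le_one)
    also have "\<dots> \<le> ((\<epsilon> * r / 2) * (\<epsilon> * r / 2) * (2 / (\<epsilon> * r))\<^sup>2) * (1 + (norm (f c))\<^sup>2)"
      using \<epsilon> r by (intro mult_right_mono) (auto simp: power2_eq_square)
    also have "\<dots> = ((\<epsilon> * r / 2) * (\<epsilon> * r / 2)) * ((2 / (\<epsilon> * r))\<^sup>2 * (1 + (norm (f c))\<^sup>2))"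
      by (simp only: mult.assoc)
    also have "\<dots> \<le> (s1 * s1 powr \<alpha>) * norm (deriv f c)"
      using big s1 p2 \<epsilon> r by (intro mult_mono) (auto intro: order_trans)
    finally show ?thesis by (simp add: Q_def)
  qed
  then have cC: "(c, s1) \<in> \<CC>"
    using Q_lower[OF ccb s1(1)] ccb s1 dc r by (auto simp: \<CC>_def)
  have ddpos: "dd (fst p) > 0" if "p \<in> \<CC>" for p
    using that s0 by (auto simp: \<CC>_def)
  have "continuous_on \<CC> (\<lambda>p. snd p / dd (fst p))"
    unfolding dd_def
  proof (intro continuous_intros)
    show "\<forall>p\<in>\<CC>. r - norm (fst p - a) \<noteq> 0"
      using ddpos by (force simp: dd_def)
  qed
  then obtain p where p: "p \<in> \<CC>" and pmin: "\<And>q. q \<in> \<CC> \<Longrightarrow> snd p / dd (fst p) \<le> snd q / dd (fst q)"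
    using continuous_attains_inf[OF \<open>compact \<CC>\<close>, of "\<lambda>p. snd p / dd (fst p)"] cC by blast
  define b where "b = fst p"
  define \<rho> where "\<rho> = snd p"
  define t where "t = \<rho> / dd b"
  have pb: "\<rho> \<ge> s0" "\<rho> \<le> dd b" "Q b \<rho>" and bcb: "b \<in> cball a r"
    using p by (auto simp: \<CC>_def b_def \<rho>_def)
  have db: "dd b > 0" "dd b \<le> 1"
  proof -
    show "dd b > 0" using ddpos[OF p] by (simp add: b_def)
    have "dd b \<le> r" by (simp add: dd_def)
    with r show "dd b \<le> 1" by linarith
  qed
  have t: "0 < t" "\<rho> = t * dd b"
    using pb s0 db by (auto simp: t_def)
  have smaller: "\<not> Q z s" if "z \<in> cball a r" "0 < s" "s < t * dd z" for z s
  proof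
    assume Qz: "Q z s"
    have "dd z > 0"
      using that t by (smt (verit) mult_nonneg_nonpos)
    moreover have "t \<le> 1"
      using pb db by (simp add: t_def)
    ultimately have "t * dd z \<le> dd z"
      by (simp add: mult_left_le_one_le t(1) less_imp_le)
    moreover have "dd z \<le> 1" using r by (simp add: dd_def) (smt (verit) norm_ge_zero)
    ultimately have "(z, s) \<in> \<CC>"
      using that Qz Q_lower[OF that(1,2) Qz] by (auto simp: \<CC>_def)
    from pmin[OF this] have "t \<le> s / dd z"
      by (simp add: t_def b_def \<rho>_def)
    then show False
      using that \<open>dd z > 0\<close> by (simp add: field_simps)
  qed
  show thesis
  proof (rule that)
    show "0 < t" by fact
    show "t \<le> \<epsilon>"
      using pmin[OF cC] dc r by (simp add: t_def b_def \<rho>_def s1_def)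
    show "b \<in> ball a r"
      using db by (simp add: dd_def dist_norm norm_minus_commute)
    show "0 < \<rho>" using pb s0 by simp
    show "\<rho> \<le> t"
      using t db by (simp add: mult_left_le)
    show "(\<rho> powr \<alpha>)\<^sup>2 + (norm (f b))\<^sup>2 \<le> \<rho> * \<rho> powr \<alpha> * norm (deriv f b)"
      using pb(3) by (simp add: Q_def)
    fix w :: complex assume w: "norm w < 1 / (2 * t)"
    define z where "z = b + of_real \<rho> * w"
    have "norm (z - a) \<le> norm (b - a) + \<rho> * norm w"
      using norm_triangle_ineq[of "b - a" "of_real \<rho> * w"] \<open>0 < \<rho>\<close>
      by (simp add: z_def norm_mult algebra_simps)
    then have "dd z \<ge> dd b - \<rho> * norm w"
      by (simp add: dd_def)
    moreover have "\<rho> * norm w < \<rho> * (1 / (2 * t))"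
      using w \<open>0 < \<rho>\<close> by (intro mult_strict_left_mono)
    then have "\<rho> * norm w < dd b / 2"
      using t by (simp add: field_simps)
    ultimately have dz: "dd z > dd b / 2" by linarith
    then have zb: "z \<in> ball a r"
      using db by (simp add: dd_def dist_norm norm_minus_commute)
    have "\<rho> / 2 < t * dd z"
      using dz t by (simp add: field_simps)
    then have "\<not> Q z (\<rho> / 2)"
      using smaller[of z "\<rho> / 2"] zb \<open>0 < \<rho>\<close> by simp
    then have 1: "\<rho> / 2 * (\<rho> / 2) powr \<alpha> * norm (deriv f z) \<le> ((\<rho> / 2) powr \<alpha>)\<^sup>2 + (norm (f z))\<^sup>2"
      by (simp add: Q_def)
    have 2: "(\<rho> / 2) powr \<alpha> \<le> \<rho> powr \<alpha>"
      using \<open>0 < \<rho>\<close> \<alpha> by (intro powr_mono2) auto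
    have "(1/2 :: real) powr 1 \<le> (1/2) powr \<alpha>"
      using \<alpha> by (intro powr_mono') auto
    then have 3: "\<rho> powr \<alpha> / 2 \<le> (\<rho> / 2) powr \<alpha>"
      using \<open>0 < \<rho>\<close> mult_left_mono[of "1/2" "(1/2) powr \<alpha>" "\<rho> powr \<alpha>"] powr_mult[of \<rho> "1/2" \<alpha>] by simp
    have "\<rho> / 2 * (\<rho> powr \<alpha> / 2) * norm (deriv f z) \<le> \<rho> / 2 * (\<rho> / 2) powr \<alpha> * norm (deriv f z)"
      using 3 \<open>0 < \<rho>\<close> by (intro mult_right_mono mult_left_mono) auto
    also note 1
    also have "((\<rho> / 2) powr \<alpha>)\<^sup>2 + (norm (f z))\<^sup>2 \<le> (\<rho> powr \<alpha>)\<^sup>2 + (norm (f z))\<^sup>2"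
      using 2 by (intro add_right_mono power_mono) auto
    finally show "b + of_real \<rho> * w \<in> ball a r \<and>
       \<rho> * \<rho> powr \<alpha> * norm (deriv f (b + of_real \<rho> * w)) \<le> 4 * ((\<rho> powr \<alpha>)\<^sup>2 + (norm (f (b + of_real \<rho> * w)))\<^sup>2)"
      using zb by (simp add: z_def)
  qed
qed

lemma rescaled_spherical_derivative:
  fixes \<rho> \<alpha> :: real
  assumes f: "f holomorphic_on D" "open D" and z: "b + of_real \<rho> * w \<in> D" and \<rho>: "\<rho> > 0"
  shows "norm (deriv (\<lambda>w. f (b + of_real \<rho> * w) / of_real (\<rho> powr \<alpha>)) w)
           = \<rho> * norm (deriv f (b + of_real \<rho> * w)) / \<rho> powr \<alpha>"
proof -
  have "(f has_field_derivative deriv f (b + of_real \<rho> * w)) (at (b + of_real \<rho> * w))"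
    using f z by (intro holomorphic_derivI)
  then have "((\<lambda>w. f (b + of_real \<rho> * w)) has_field_derivative deriv f (b + of_real \<rho> * w) * of_real \<rho>) (at w)"
    by (rule DERIV_chain2) (auto intro!: derivative_eq_intros)
  then have "((\<lambda>w. f (b + of_real \<rho> * w) / of_real (\<rho> powr \<alpha>)) has_field_derivative
      deriv f (b + of_real \<rho> * w) * of_real \<rho> / of_real (\<rho> powr \<alpha>)) (at w)"
    by (rule DERIV_cdivide)
  then show ?thesis
    using \<rho> by (simp add: DERIV_imp_deriv norm_mult norm_divide)
qed

text \<open>
  The rescaled functions have spherical derivative at least \<open>1\<close> at \<open>0\<close> and at most \<open>4\<close> on discs that
  exhaust the plane, so they obey the uniform bound of \<open>normalized_exponential_bound\<close>. The lower
  bound at \<open>0\<close> keeps the limit from being constant.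
\<close>

lemma zalcman_pang:
  assumes D: "open D" and a: "a \<in> D" and hol: "\<And>f. f \<in> \<F> \<Longrightarrow> f holomorphic_on D"
    and unb: "\<not> spherical_deriv_bounded_near \<F> a" and \<alpha>: "0 \<le> \<alpha>" "\<alpha> < 1"
  obtains f b \<rho> g z0 where
    "\<And>m. f m \<in> \<F>" "\<And>m. \<rho> m > 0" "\<rho> \<longlonglongrightarrow> 0" "b \<longlonglongrightarrow> z0" "z0 \<in> D"
    "\<And>R. \<forall>\<^sub>F m in sequentially. \<forall>w\<in>ball 0 R. b m + of_real (\<rho> m) * w \<in> D"
    "entire_limit (\<lambda>m w. f m (b m + of_real (\<rho> m) * w) / of_real (\<rho> m powr \<alpha>)) g"
    "exp_type g" "\<not> g constant_on UNIV"
proof -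
  obtain r0 where r0: "r0 > 0" "cball a r0 \<subseteq> D"
    using D a open_contains_cball by blast
  define r where "r = min r0 1"
  have r: "0 < r" "r \<le> 1" "cball a r \<subseteq> D"
    using r0 by (auto simp: r_def)
  define Good where "Good m f b \<rho> \<longleftrightarrow> f \<in> \<F> \<and> b \<in> ball a r \<and> 0 < \<rho> \<and> \<rho> \<le> 1 / real (Suc m) \<and>
      (\<rho> powr \<alpha>)\<^sup>2 + (norm (f b))\<^sup>2 \<le> \<rho> * \<rho> powr \<alpha> * norm (deriv f b) \<and>
      (\<forall>w. norm w < real (Suc m) / 2 \<longrightarrow> b + of_real \<rho> * w \<in> ball a r \<and>
       \<rho> * \<rho> powr \<alpha> * norm (deriv f (b + of_real \<rho> * w)) \<le> 4 * ((\<rho> powr \<alpha>)\<^sup>2 + (norm (f (b + of_real \<rho> * w)))\<^sup>2))"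
    for m f b \<rho>
  have "\<exists>f b \<rho>. Good m f b \<rho>" for m
  proof -
    define \<epsilon> where "\<epsilon> = 1 / real (Suc m)"
    have \<epsilon>: "0 < \<epsilon>" "\<epsilon> \<le> 1" by (auto simp: \<epsilon>_def)
    obtain f c where f: "f \<in> \<F>" and c: "c \<in> ball a (r / 2)"
      and big: "\<not> norm (deriv f c) \<le> (2 / (\<epsilon> * r))\<^sup>2 * (1 + (norm (f c))\<^sup>2)"
      using unb r(1) unfolding spherical_deriv_bounded_near_def
      by (metis half_gt_zero zero_le_power2)
    obtain b \<rho> t where bt: "0 < t" "t \<le> \<epsilon>" "b \<in> ball a r" "0 < \<rho>" "\<rho> \<le> t"
      "(\<rho> powr \<alpha>)\<^sup>2 + (norm (f b))\<^sup>2 \<le> \<rho> * \<rho> powr \<alpha> * norm (deriv f b)"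
      "\<And>w. norm w < 1 / (2 * t) \<Longrightarrow> b + of_real \<rho> * w \<in> ball a r \<and>
         \<rho> * \<rho> powr \<alpha> * norm (deriv f (b + of_real \<rho> * w)) \<le> 4 * ((\<rho> powr \<alpha>)\<^sup>2 + (norm (f (b + of_real \<rho> * w)))\<^sup>2)"
      by (rule zalcman_pang_point[OF \<alpha> r(1,2) \<epsilon> D r(3) hol[OF f], of c])
         (use c big in \<open>auto simp: dist_norm norm_minus_commute\<close>)
    have "real (Suc m) / 2 \<le> 1 / (2 * t)"
      using bt(1,2) by (simp add: \<epsilon>_def field_simps)
    then have "Good m f b \<rho>"
      unfolding Good_def using f bt by (auto simp: \<epsilon>_def simp del: of_nat_Suc)
    then show ?thesis by blast
  qed
  then obtain f b \<rho> where good: "\<And>m. Good m (f m) (b m) (\<rho> m)"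
    by metis
  have fF: "f m \<in> \<F>" and b_in: "b m \<in> ball a r" and \<rho>_pos: "\<rho> m > 0" and \<rho>_le: "\<rho> m \<le> 1 / real (Suc m)"
    and at0: "(\<rho> m powr \<alpha>)\<^sup>2 + (norm (f m (b m)))\<^sup>2 \<le> \<rho> m * \<rho> m powr \<alpha> * norm (deriv (f m) (b m))"
    and near: "\<And>w. norm w < real (Suc m) / 2 \<Longrightarrow> b m + of_real (\<rho> m) * w \<in> ball a r"
    and sph: "\<And>w. norm w < real (Suc m) / 2 \<Longrightarrow> \<rho> m * \<rho> m powr \<alpha> * norm (deriv (f m) (b m + of_real (\<rho> m) * w))
        \<le> 4 * ((\<rho> m powr \<alpha>)\<^sup>2 + (norm (f m (b m + of_real (\<rho> m) * w)))\<^sup>2)" for m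
    using good[of m] unfolding Good_def by blast+
  have inD: "b m + of_real (\<rho> m) * w \<in> D" if "norm w < real (Suc m) / 2" for m w
    using near[OF that] r(3) by auto
  define h where "h m w = f m (b m + of_real (\<rho> m) * w) / of_real (\<rho> m powr \<alpha>)" for m w
  have h_hol: "h m holomorphic_on ball 0 (real (Suc m) / 2)" for m
  proof -
    have "(\<lambda>w. f m (b m + of_real (\<rho> m) * w)) holomorphic_on ball 0 (real (Suc m) / 2)"
      by (rule holomorphic_on_compose_gen[OF _ hol[OF fF], unfolded o_def])
         (use inD in \<open>auto intro!: holomorphic_intros\<close>)
    then show ?thesis
      unfolding h_def using \<rho>_pos[of m] by (intro holomorphic_intros) auto
  qed
  have h_deriv: "norm (deriv (h m) w) = \<rho> m * norm (deriv (f m) (b m + of_real (\<rho> m) * w)) / \<rho> m powr \<alpha>"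
    if "norm w < real (Suc m) / 2" for m w
    unfolding h_def by (rule rescaled_spherical_derivative[OF hol[OF fF] D inD[OF that] \<rho>_pos])
  have h_sq: "(norm (h m w))\<^sup>2 = (norm (f m (b m + of_real (\<rho> m) * w)))\<^sup>2 / (\<rho> m powr \<alpha>)\<^sup>2" for m w
    by (simp add: h_def norm_divide power_divide)
  have h_sph: "norm (deriv (h m) w) \<le> 4 * (1 + (norm (h m w))\<^sup>2)" if "norm w < real (Suc m) / 2" for m w
    unfolding h_deriv[OF that] h_sq
    using sph[OF that] \<rho>_pos[of m] by (simp add: field_simps power2_eq_square)
  have h_0: "1 + (norm (h m 0))\<^sup>2 \<le> norm (deriv (h m) 0)" for m
  proof -
    have d: "norm (deriv (h m) 0) = \<rho> m * norm (deriv (f m) (b m)) / \<rho> m powr \<alpha>"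
      using h_deriv[of 0 m] by simp
    have s: "(norm (h m 0))\<^sup>2 = (norm (f m (b m)))\<^sup>2 / (\<rho> m powr \<alpha>)\<^sup>2"
      using h_sq[of m 0] by simp
    have "1 + (norm (h m 0))\<^sup>2 = ((\<rho> m powr \<alpha>)\<^sup>2 + (norm (f m (b m)))\<^sup>2) / (\<rho> m powr \<alpha>)\<^sup>2"
      unfolding s using \<rho>_pos[of m] by (simp add: add_divide_distrib)
    also have "\<dots> \<le> \<rho> m * \<rho> m powr \<alpha> * norm (deriv (f m) (b m)) / (\<rho> m powr \<alpha>)\<^sup>2"
      using at0[of m] by (intro divide_right_mono) auto
    also have "\<dots> = norm (deriv (h m) 0)"
      unfolding d using \<rho>_pos[of m] by (simp add: power2_eq_square)
    finally show ?thesis .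
  qed
  define C where "C = exp (4 * 4 :: real)"
  define E where "E x = C * exp (2 * 4 * (C + 1 / C) * x)" for x
  have Epos: "C > 0" by (simp add: C_def)
  have h_bound: "norm (h m w) \<le> E (norm w)" if "m \<ge> 4" "norm w < real (Suc m) / 4" for m w
    unfolding E_def
  proof -
    have half: "2 * (real (Suc m) / 4) = real (Suc m) / 2" by simp
    show "norm (h m w) \<le> C * exp (2 * 4 * (C + 1 / C) * norm w)"
    proof (rule normalized_exponential_bound[where R = "real (Suc m) / 4" and M = 4])
      show "h m holomorphic_on ball 0 (2 * (real (Suc m) / 4))"
        unfolding half by (rule h_hol)
      show "norm (deriv (h m) z) \<le> 4 * (1 + (norm (h m z))\<^sup>2)" if "z \<in> ball 0 (2 * (real (Suc m) / 4))" for z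
        using h_sph[of z m] that unfolding half by simp
    qed (use that h_0 in \<open>auto simp: C_def\<close>)
  qed
  \<comment> \<open>this reindexing puts the disc of radius \<open>m\<close> inside the domain of the bound\<close>
  define G where "G m = h (4 * m + 4)" for m
  have "G m holomorphic_on ball 0 (real m)" for m
    unfolding G_def by (rule holomorphic_on_subset[OF h_hol]) auto
  moreover have "norm (G m w) \<le> E (norm w)" if "w \<in> ball 0 (real m)" for m w
    unfolding G_def using that by (intro h_bound) auto
  moreover have "mono E"
    unfolding E_def by (intro monoI mult_left_mono) (use Epos in \<open>auto intro!: mult_left_mono\<close>)
  ultimately obtain k g where k: "strict_mono k" and lim: "entire_limit (\<lambda>m. G (k m)) g"
    using montel_growing_discs by metis
  have g_le: "norm (g w) \<le> E (norm w)" for w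
  proof -
    have "(\<lambda>m. norm (G (k m) w)) \<longlonglongrightarrow> norm (g w)"
      by (intro tendsto_norm entire_limit_tendsto lim)
    moreover have "\<forall>\<^sub>F m in sequentially. norm (G (k m) w) \<le> E (norm w)"
    proof -
      obtain M where M: "norm w < real M" using reals_Archimedean2 by blast
      show ?thesis
        using eventually_ge_at_top[of M]
      proof eventually_elim
        case (elim m)
        then have "real M \<le> real (k m)" using seq_suble[OF k, of m] by simp
        then show ?case unfolding G_def using M by (intro h_bound) auto
      qed
    qed
    ultimately show ?thesis by (rule tendsto_upperbound) auto
  qed
  then have "exp_type g" unfolding exp_type_def E_def by blast
  have "\<not> g constant_on UNIV"
  proof
    assume "g constant_on UNIV"
    then obtain c where "g = (\<lambda>_. c)" by (auto simp: constant_on_def)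
    then have "deriv g 0 = 0" by simp
    moreover have "(\<lambda>m. norm (deriv (G (k m)) 0)) \<longlonglongrightarrow> norm (deriv g 0)"
      by (intro tendsto_norm entire_limit_tendsto[OF entire_limit_deriv[OF lim]])
    moreover have "1 \<le> norm (deriv (G (k m)) 0)" for m
      using h_0[of "4 * k m + 4"] zero_le_power2[of "norm (h (4 * k m + 4) 0)"] unfolding G_def by linarith
    ultimately show False
      using tendsto_lowerbound[of "\<lambda>m. norm (deriv (G (k m)) 0)" "norm (deriv g 0)" sequentially 1] by simp
  qed
  have "\<forall>m. b (4 * k m + 4) \<in> cball a r" using b_in by (auto intro: less_imp_le)
  then obtain z0 q where z0: "z0 \<in> cball a r" and q: "strict_mono (q :: nat \<Rightarrow> nat)"
    and bz: "((\<lambda>m. b (4 * k m + 4)) \<circ> q) \<longlonglongrightarrow> z0"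
    using compact_cball[of a r] unfolding compact_def by meson
  define \<kappa> where "\<kappa> m = 4 * k (q m) + 4" for m
  have \<kappa>_ge: "\<kappa> m \<ge> m" for m
    using seq_suble[OF k, of "q m"] seq_suble[OF q, of m] by (simp add: \<kappa>_def)
  show thesis
  proof (rule that[of "\<lambda>m. f (\<kappa> m)" "\<lambda>m. \<rho> (\<kappa> m)" "\<lambda>m. b (\<kappa> m)" z0 g])
    show "f (\<kappa> m) \<in> \<F>" "\<rho> (\<kappa> m) > 0" for m using fF \<rho>_pos by auto
    show "(\<lambda>m. \<rho> (\<kappa> m)) \<longlonglongrightarrow> 0"
    proof (rule tendsto_sandwich[of "\<lambda>_. 0" _ _ "\<lambda>m. 1 / real (Suc m)"])
      have "\<rho> (\<kappa> m) \<le> 1 / real (Suc m)" for m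
        by (rule order_trans[OF \<rho>_le]) (use \<kappa>_ge[of m] in \<open>simp add: frac_le\<close>)
      then show "\<forall>\<^sub>F m in sequentially. \<rho> (\<kappa> m) \<le> 1 / real (Suc m)" by simp
      show "\<forall>\<^sub>F m in sequentially. 0 \<le> \<rho> (\<kappa> m)" using \<rho>_pos by (simp add: less_imp_le)
    qed (use LIMSEQ_Suc[OF lim_1_over_n] in auto)
    show "(\<lambda>m. b (\<kappa> m)) \<longlonglongrightarrow> z0" using bz by (simp add: o_def \<kappa>_def)
    show "z0 \<in> D" using z0 r by auto
    show "\<forall>\<^sub>F m in sequentially. \<forall>w\<in>ball 0 R. b (\<kappa> m) + of_real (\<rho> (\<kappa> m)) * w \<in> D" for R
    proof -
      obtain M where M: "2 * R < real M" using reals_Archimedean2 by blast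
      show ?thesis
        using eventually_ge_at_top[of M]
      proof eventually_elim
        case (elim m)
        then have "real M \<le> real (\<kappa> m)" using \<kappa>_ge[of m] by simp
        then show ?case using M by (intro ballI inD) auto
      qed
    qed
    have "entire_limit (\<lambda>m. G (k (q m))) g"
      using lim by (auto simp: entire_limit_def intro: eventually_subseq[OF q] filterlim_compose[OF _ filterlim_subseq[OF q]])
    then show "entire_limit (\<lambda>m w. f (\<kappa> m) (b (\<kappa> m) + of_real (\<rho> (\<kappa> m)) * w) / of_real (\<rho> (\<kappa> m) powr \<alpha>)) g"
      by (simp add: G_def h_def[abs_def] \<kappa>_def)
    show "exp_type g" "\<not> g constant_on UNIV" by fact+
  qed
qed

section \<open>Normality of families sharing a value\<close>

text \<open>
  In the application \<open>\<rho>\<close> is the scale and \<open>c = \<rho> powr \<alpha>\<close> with \<open>\<alpha> = T / N\<close>: the monomial is homogeneous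
  of degree \<open>N\<close> in the function, and differentiation contributes the factor \<open>\<rho> ^ T\<close>.
\<close>

lemma diff_monomial_rescale:
  fixes ns ts :: "nat \<Rightarrow> nat"
  assumes f: "f holomorphic_on D" and D: "open D" and S: "open S" "w \<in> S" "\<And>w. w \<in> S \<Longrightarrow> b + \<rho> * w \<in> D"
    and c: "c \<noteq> 0" "c ^ (n + (\<Sum>j=1..k. ns j)) = \<rho> ^ (\<Sum>j=1..k. ts j)"
  shows "diff_monomial n k ns ts (\<lambda>w. f (b + \<rho> * w) / c) w = diff_monomial n k ns ts f (b + \<rho> * w)"
proof -
  have hd: "(deriv ^^ ts j) (\<lambda>w. (f (b + \<rho> * w) / c) ^ ns j) w
      = \<rho> ^ ts j / c ^ ns j * (deriv ^^ ts j) (\<lambda>z. f z ^ ns j) (b + \<rho> * w)" for j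
  proof -
    have hol: "(\<lambda>z. f z ^ ns j) holomorphic_on D" using f by (intro holomorphic_intros)
    have holc: "(\<lambda>w. f (\<rho> * w + b) ^ ns j) holomorphic_on S"
      by (rule holomorphic_on_compose_gen[OF _ hol, unfolded o_def])
         (use S(3) in \<open>auto intro!: holomorphic_intros simp: add.commute\<close>)
    have "(\<lambda>w. (f (b + \<rho> * w) / c) ^ ns j) = (\<lambda>w. (1 / c ^ ns j) * f (\<rho> * w + b) ^ ns j)"
      by (simp add: power_divide add.commute)
    then have "(deriv ^^ ts j) (\<lambda>w. (f (b + \<rho> * w) / c) ^ ns j) w
        = (deriv ^^ ts j) (\<lambda>w. (1 / c ^ ns j) * f (\<rho> * w + b) ^ ns j) w"
      by (simp only:)
    also have "\<dots> = (1 / c ^ ns j) * (deriv ^^ ts j) (\<lambda>w. f (\<rho> * w + b) ^ ns j) w"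
      by (rule higher_deriv_cmult[OF holc S(2,1)])
    also have "(deriv ^^ ts j) (\<lambda>w. f (\<rho> * w + b) ^ ns j) w = \<rho> ^ ts j * (deriv ^^ ts j) (\<lambda>z. f z ^ ns j) (\<rho> * w + b)"
      by (rule higher_deriv_compose_linear'[OF hol S(1) D S(2)]) (use S(3) in \<open>simp add: add.commute\<close>)
    finally show ?thesis by (simp add: add.commute)
  qed
  have "diff_monomial n k ns ts (\<lambda>w. f (b + \<rho> * w) / c) w
      = (\<rho> ^ (\<Sum>j=1..k. ts j) / c ^ (n + (\<Sum>j=1..k. ns j))) * diff_monomial n k ns ts f (b + \<rho> * w)"
    unfolding diff_monomial_def hd prod.distrib prod_dividef
    by (simp add: power_sum power_add power_divide)
  also have "\<rho> ^ (\<Sum>j=1..k. ts j) / c ^ (n + (\<Sum>j=1..k. ns j)) = 1"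
    unfolding c(2)[symmetric] using c(1) by simp
  finally show ?thesis by simp
qed

theorem theorem1p4:
  fixes p :: complex and n k :: nat and ns ts :: "nat \<Rightarrow> nat"
    and D :: "complex set" and \<F> :: "(complex \<Rightarrow> complex) set"
  assumes "p \<noteq> 0"
    and "k \<ge> 1"
    and "\<And>j. j \<in> {1..k} \<Longrightarrow> ns j > 0"
    and "\<And>j. j \<in> {1..k} \<Longrightarrow> ts j > 0"
    and "\<And>j. j \<in> {1..k} \<Longrightarrow> ns j \<ge> ts j"
    and "n + (\<Sum>j=1..k. ns j) \<ge> 2 + (\<Sum>j=1..k. ts j)"
    and "open D" and "connected D" and "D \<noteq> {}"
    and "\<And>f. f \<in> \<F> \<Longrightarrow> f holomorphic_on D"
    and "\<And>f g. f \<in> \<F> \<Longrightarrow> g \<in> \<F> \<Longrightarrow>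
           share_IM (diff_monomial n k ns ts f) (diff_monomial n k ns ts g) p D"
  shows "normal_family \<F> D"
proof (rule marty_imp_normal_family)
  define P where "P = diff_monomial n k ns ts"
  define N where "N = n + (\<Sum>j=1..k. ns j)"
  define T where "T = (\<Sum>j=1..k. ts j)"
  have NT: "N \<ge> 2 + T" using assms(6) by (simp add: N_def T_def)
  define \<alpha> where "\<alpha> = real T / real N"
  have \<alpha>: "0 \<le> \<alpha>" "\<alpha> < 1" using NT by (auto simp: \<alpha>_def)
  have P_hol: "P f holomorphic_on D" if "f \<in> \<F>" for f
    using assms(7,10) that by (simp add: P_def holomorphic_diff_monomial)
  have share: "P f z = p \<longleftrightarrow> P f' z = p" if "f \<in> \<F>" "f' \<in> \<F>" "z \<in> D" for f f' z
  proof -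
    have "sphere_val (P f) z = Some p \<longleftrightarrow> sphere_val (P f') z = Some p"
      using assms(11)[OF that(1,2)] that(3) unfolding share_IM_def P_def by blast
    then show ?thesis
      using sphere_val_holomorphic[OF P_hol assms(7) that(3)] that(1,2) by simp
  qed
  fix a assume a: "a \<in> D"
  show "spherical_deriv_bounded_near \<F> a"
  proof (rule ccontr)
    assume unb: "\<not> spherical_deriv_bounded_near \<F> a"
    obtain f b \<rho> g z0 where f: "\<And>m. f m \<in> \<F>" and \<rho>: "\<And>m. \<rho> m > 0" "\<rho> \<longlonglongrightarrow> 0" and b: "b \<longlonglongrightarrow> z0" "z0 \<in> D"
      and inD: "\<And>R. \<forall>\<^sub>F m in sequentially. \<forall>w\<in>ball 0 R. b m + of_real (\<rho> m) * w \<in> D"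
      and lim: "entire_limit (\<lambda>m w. f m (b m + of_real (\<rho> m) * w) / of_real (\<rho> m powr \<alpha>)) g"
      and g: "exp_type g" "\<not> g constant_on UNIV"
    proof (rule zalcman_pang[OF assms(7) a _ unb \<alpha>])
      fix f :: "nat \<Rightarrow> complex \<Rightarrow> complex" and b \<rho> g z0
      assume "\<And>m. f m \<in> \<F>" "\<And>m. \<rho> m > 0" "\<rho> \<longlonglongrightarrow> 0" "b \<longlonglongrightarrow> z0" "z0 \<in> D"
        "\<And>R. \<forall>\<^sub>F m in sequentially. \<forall>w\<in>ball 0 R. b m + of_real (\<rho> m) * w \<in> D"
        "entire_limit (\<lambda>m w. f m (b m + of_real (\<rho> m) * w) / of_real (\<rho> m powr \<alpha>)) g"
        "exp_type g" "\<not> g constant_on UNIV"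
      then show thesis by (rule that)
    qed (rule assms(10))
    define h where "h m w = f m (b m + of_real (\<rho> m) * w) / of_real (\<rho> m powr \<alpha>)" for m w
    have limP: "entire_limit (\<lambda>m. P (h m)) (P g)"
      unfolding P_def h_def[abs_def] by (rule entire_limit_diff_monomial[OF lim])
    have g_hol: "g holomorphic_on UNIV" using lim by (rule entire_limit_holomorphic)
    have nonconst: "\<not> P g constant_on UNIV" and attained: "\<exists>z. P g z = p \<and> z \<noteq> c" for c
      using diff_monomial_two_values[OF g_hol g assms(1,3,5,6)] unfolding P_def by auto
    obtain \<zeta> \<zeta>' where \<zeta>: "P g \<zeta> = p" "P g \<zeta>' = p" "\<zeta> \<noteq> \<zeta>'"
      using attained by metis
    have rescale: "P (h m) w = P (f m) (b m + of_real (\<rho> m) * w)"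
      if "w \<in> ball 0 R" "\<forall>w\<in>ball 0 R. b m + of_real (\<rho> m) * w \<in> D" for m w R
    proof -
      have "(\<rho> m powr \<alpha>) ^ N = \<rho> m ^ T"
        using \<rho>(1)[of m] NT by (simp add: \<alpha>_def powr_powr flip: powr_realpow)
      then have "(of_real (\<rho> m powr \<alpha>) :: complex) ^ N = of_real (\<rho> m) ^ T"
        by (metis of_real_power)
      then show ?thesis
        unfolding P_def h_def[abs_def] N_def T_def
        by (intro diff_monomial_rescale[OF assms(10)[OF f] assms(7) open_ball that(1)]) (use that(2) \<rho>(1)[of m] in auto)
    qed
    have P_not_p: "\<exists>z\<in>D. P (f 0) z \<noteq> p"
    proof (rule ccontr)
      assume "\<not> ?thesis"
      then have all: "P (f m) z = p" if "z \<in> D" for m z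
        using share[OF f f that] that by blast
      have "P g w = p" for w
      proof -
        have "\<forall>\<^sub>F m in sequentially. P (h m) w = p"
          using inD[of "norm w + 1"]
          by eventually_elim (use all in \<open>auto simp: rescale[of w "norm w + 1"]\<close>)
        then have "(\<lambda>m. P (h m) w) \<longlonglongrightarrow> p"
          by (rule tendsto_eventually)
        then show ?thesis
          using entire_limit_tendsto[OF limP, of w] LIMSEQ_unique by blast
      qed
      then show False using nonconst by (auto simp: constant_on_def)
    qed
    define \<epsilon> where "\<epsilon> = dist \<zeta> \<zeta>' / 2"
    have \<epsilon>: "\<epsilon> > 0" using \<zeta>(3) by (simp add: \<epsilon>_def)
    define R where "R = norm \<zeta> + norm \<zeta>' + \<epsilon>"
    have "\<exists>e>0. \<forall>z\<in>ball z0 e. z \<in> D \<and> (P (f 0) z = p \<longrightarrow> z = z0)"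
    proof (rule ccontr)
      assume none: "\<not> ?thesis"
      have "z0 islimpt {z \<in> D. P (f 0) z - p = 0}"
        unfolding islimpt_approachable
      proof (intro allI impI)
        fix e :: real assume "e > 0"
        obtain e' where e': "e' > 0" "ball z0 e' \<subseteq> D" using assms(7) b(2) openE by blast
        then obtain z where "z \<in> ball z0 (min e e')" "\<not> (z \<in> D \<and> (P (f 0) z = p \<longrightarrow> z = z0))"
          using none \<open>e > 0\<close> by (metis min_less_iff_conj)
        then show "\<exists>x'\<in>{z \<in> D. P (f 0) z - p = 0}. x' \<noteq> z0 \<and> dist x' z0 < e"
          using e' by (intro bexI[of _ z]) (auto simp: dist_commute subset_iff)
      qed
      moreover have "(\<lambda>z. P (f 0) z - p) holomorphic_on D"
        using P_hol[OF f] by (intro holomorphic_intros)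
      ultimately have "P (f 0) z - p = 0" if "z \<in> D" for z
        using analytic_continuation[of "\<lambda>z. P (f 0) z - p" D "{z \<in> D. P (f 0) z - p = 0}" z0 z]
          assms(7,8) b(2) that by auto
      then show False using P_not_p by auto
    qed
    then obtain e where e: "e > 0" and iso: "\<And>z. z \<in> ball z0 e \<Longrightarrow> z \<in> D \<and> (P (f 0) z = p \<longrightarrow> z = z0)"
      by blast
    \<comment> \<open>for large \<open>m\<close>, \<open>z0\<close> is the only candidate for a shared \<open>p\<close>-point in the rescaled disc\<close>
    have only_z0: "b m + of_real (\<rho> m) * w = z0"
      if "P (h m) w = p" "w \<in> ball 0 R" "\<forall>w\<in>ball 0 R. b m + of_real (\<rho> m) * w \<in> D"
         "dist (b m) z0 < e / 2" "\<rho> m * R < e / 2" for m w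
    proof -
      have "norm (of_real (\<rho> m) * w) \<le> \<rho> m * R"
        using that(2) \<rho>(1)[of m] by (auto simp: norm_mult intro!: mult_left_mono)
      then have "dist (b m + of_real (\<rho> m) * w) (b m) < e / 2"
        using that(5) by (simp add: dist_norm)
      then have "b m + of_real (\<rho> m) * w \<in> ball z0 e"
        using that(4) dist_triangle_half_r[of "b m" "b m + of_real (\<rho> m) * w" e z0]
        by (simp add: dist_commute)
      moreover have "P (f m) (b m + of_real (\<rho> m) * w) = p"
        using rescale[OF that(2,3)] that(1) by simp
      ultimately show ?thesis
        using iso share[OF f f] by blast
    qed
    have "(\<lambda>m. \<rho> m * R) \<longlonglongrightarrow> 0"
      using \<rho>(2) by (rule tendsto_mult_left_zero)
    then have "\<forall>\<^sub>F m in sequentially. \<rho> m * R < e / 2"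
      by (rule order_tendstoD) (use e in simp)
    moreover have "\<forall>\<^sub>F m in sequentially. dist (b m) z0 < e / 2"
      using b(1) by (rule tendstoD) (use e in simp)
    moreover have "\<forall>\<^sub>F m in sequentially. \<exists>w\<in>ball \<zeta> \<epsilon>. P (h m) w = p"
      by (rule entire_limit_hurwitz[OF limP \<zeta>(1) nonconst \<epsilon>])
    moreover have "\<forall>\<^sub>F m in sequentially. \<exists>w\<in>ball \<zeta>' \<epsilon>. P (h m) w = p"
      by (rule entire_limit_hurwitz[OF limP \<zeta>(2) nonconst \<epsilon>])
    ultimately have "\<forall>\<^sub>F m in sequentially. False"
      using inD[of R]
    proof eventually_elim
      case (elim m)
      obtain w w' where w: "w \<in> ball \<zeta> \<epsilon>" "P (h m) w = p" and w': "w' \<in> ball \<zeta>' \<epsilon>" "P (h m) w' = p"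
        using elim by blast
      have "ball \<zeta> \<epsilon> \<subseteq> ball 0 R" "ball \<zeta>' \<epsilon> \<subseteq> ball 0 R"
        by (auto intro!: ball_subset_ball_iff[THEN iffD2] simp: R_def dist_norm)
      then have "w \<in> ball 0 R" "w' \<in> ball 0 R" using w w' by auto
      then have "b m + of_real (\<rho> m) * w = b m + of_real (\<rho> m) * w'"
        using only_z0[OF w(2)] only_z0[OF w'(2)] elim by simp
      then have "w = w'" using \<rho>(1)[of m] by simp
      then have "dist \<zeta> \<zeta>' < \<epsilon> + \<epsilon>"
        using w(1) w'(1) dist_triangle_less_add[of \<zeta> w \<epsilon> \<zeta>' \<epsilon>] by (simp add: dist_commute)
      then show False by (simp add: \<epsilon>_def)
    qed
    then show False by simp
  qed
qed (use assms in auto)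

end
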